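(* Let $\Omega\subset\mathbb{R}^N$ be a nonempty bounded open set, $0<s<1$, $1<p<\infty$ and $0<\alpha\le\beta<\infty$. Let $a_n\in L^\infty(\mathbb{R}^N\times\mathbb{R}^N)$, $n\ge0$, satisfy $a_n(x,y)=a_n(y,x)$ and $\alpha\le a_n(x,y)\le\beta$ a.e., and suppose that $a_n\to a_0$ weakly* in $L^\infty(\mathbb{R}^N\times\mathbb{R}^N)$ as $n\to\infty$. For $n\ge0$ and $v\in W^{s,p}_0(\Omega)$ let $$F_n(v)=\Big(\iint_{\mathbb{R}^N\times\mathbb{R}^N}a_n(x,y)\frac{|v(x)-v(y)|^p}{|x-y|^{N+sp}}\,dx\,dy\Big)^{1/p},$$ and for $k\in\mathbb{N}$ (with $k\ge1$) let $$\lambda_k^n=\inf_{G\in\mathcal{G}^k_{s,p}}\ \sup_{v\in G}\ \frac{F_n(v)}{\|v\|_p}.$$ Then $$\lim_{n\to\infty}\lambda_k^n=\lambda_k^0\quad\text{for all }k\in\mathbb{N}.$$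
   Context: For $0<s<1\le p<\infty$, $$[u]_{s,p}=\Big(\iint_{\mathbb{R}^N\times\mathbb{R}^N}\frac{|u(x)-u(y)|^p}{|x-y|^{N+sp}}\,dx\,dy\Big)^{1/p},$$ $W^{s,p}(\mathbb{R}^N)=\{u\in L^p(\mathbb{R}^N): [u]_{s,p}<\infty\}$ with norm $(\|u\|_p^p+[u]_{s,p}^p)^{1/p}$, and $W^{s,p}_0(\Omega)=\{u\in W^{s,p}(\mathbb{R}^N): u=0\text{ a.e. in }\mathbb{R}^N\setminus\Omega\}$. Krasnoselskii genus: for a nonempty closed symmetric set $A=-A$ in a real Banach space, $\gamma(A)=\inf\{m\in\mathbb{N}: \text{there is a continuous odd map }\varphi\colon A\to\mathbb{R}^m\setminus\{0\}\}$, with $\inf\emptyset=\infty$. $\mathcal{G}^k_{s,p}$ is the family of nonempty sets $G\subset W^{s,p}_0(\Omega)$ with $G=-G$, $G$ closed and bounded in $W^{s,p}_0(\Omega)$, $\|u\|_p=1$ for all $u\in G$, and $\gamma(G)\ge k$. *)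

theory Defs
  imports "HOL-Analysis.Analysis"
begin

text \<open>
  Elements of the function spaces are represented by Lebesgue measurable functions; almost everywhere
  equality is not divided out.  Bochner integrals of non-integrable functions are \<open>0\<close>, so that
  finiteness of a norm is stated as integrability in the definition of the space.
\<close>

definition Lp_norm :: "real \<Rightarrow> ('a::euclidean_space \<Rightarrow> real) \<Rightarrow> real" where
  "Lp_norm p u = (LINT x|lebesgue. \<bar>u x\<bar> powr p) powr (1 / p)"

definition Lp_space :: "real \<Rightarrow> ('a::euclidean_space \<Rightarrow> real) set" where
  "Lp_space p = {u \<in> borel_measurable lebesgue. integrable lebesgue (\<lambda>x. \<bar>u x\<bar> powr p)}"

text \<open>On the null set \<open>x = y\<close> the quotient below is \<open>0\<close>.\<close>

definition gagliardo_quotient ::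
    "real \<Rightarrow> real \<Rightarrow> ('a::euclidean_space \<Rightarrow> real) \<Rightarrow> 'a \<times> 'a \<Rightarrow> real" where
  "gagliardo_quotient s p u =
     (\<lambda>(x, y). \<bar>u x - u y\<bar> powr p / norm (x - y) powr (real DIM('a) + s * p))"

definition gagliardo_seminorm :: "real \<Rightarrow> real \<Rightarrow> ('a::euclidean_space \<Rightarrow> real) \<Rightarrow> real" where
  "gagliardo_seminorm s p u = (LINT z|lebesgue. gagliardo_quotient s p u z) powr (1 / p)"

definition Wsp_space :: "real \<Rightarrow> real \<Rightarrow> ('a::euclidean_space \<Rightarrow> real) set" where
  "Wsp_space s p = {u \<in> Lp_space p. integrable lebesgue (gagliardo_quotient s p u)}"

definition Wsp_norm :: "real \<Rightarrow> real \<Rightarrow> ('a::euclidean_space \<Rightarrow> real) \<Rightarrow> real" where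
  "Wsp_norm s p u = (Lp_norm p u powr p + gagliardo_seminorm s p u powr p) powr (1 / p)"

definition Wsp0_space :: "'a::euclidean_space set \<Rightarrow> real \<Rightarrow> real \<Rightarrow> ('a \<Rightarrow> real) set" where
  "Wsp0_space \<Omega> s p = {u \<in> Wsp_space s p. AE x in lebesgue. x \<notin> \<Omega> \<longrightarrow> u x = 0}"

text \<open>
  The norm topology.  On representatives it comes from a pseudometric, so its closed sets are
  unions of almost-everywhere-equality classes, and maps from a subspace into a Hausdorff space that
  are continuous factor through the classes (see \<open>closedin_Wsp0_AE_eq\<close> and
  \<open>continuous_map_Wsp0_AE_eq\<close>).  Hence closed sets, continuous maps into
  \<open>\<real>\<^sup>m \<setminus> {0}\<close> and the genus are those of the Banach space of classes.
\<close>

definition Wsp0_topology ::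
    "'a::euclidean_space set \<Rightarrow> real \<Rightarrow> real \<Rightarrow> ('a \<Rightarrow> real) topology" where
  "Wsp0_topology \<Omega> s p = topology (\<lambda>U. U \<subseteq> Wsp0_space \<Omega> s p \<and>
     (\<forall>u\<in>U. \<exists>e>0. \<forall>v\<in>Wsp0_space \<Omega> s p. Wsp_norm s p (v - u) < e \<longrightarrow> v \<in> U))"

lemma openin_Wsp0_topology:
  "openin (Wsp0_topology \<Omega> s p) U \<longleftrightarrow> U \<subseteq> Wsp0_space \<Omega> s p \<and>
     (\<forall>u\<in>U. \<exists>e>0. \<forall>v\<in>Wsp0_space \<Omega> s p. Wsp_norm s p (v - u) < e \<longrightarrow> v \<in> U)"
proof -
  let ?W = "Wsp0_space \<Omega> s p"
  let ?P = "\<lambda>U. U \<subseteq> ?W \<and> (\<forall>u\<in>U. \<exists>e>0. \<forall>v\<in>?W. Wsp_norm s p (v - u) < e \<longrightarrow> v \<in> U)"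
  have inter: "?P (S \<inter> T)" if S: "?P S" and T: "?P T" for S T
  proof (intro conjI ballI)
    show "S \<inter> T \<subseteq> ?W" using S by blast
    fix u assume u: "u \<in> S \<inter> T"
    obtain d where d: "d > 0" "\<forall>v\<in>?W. Wsp_norm s p (v - u) < d \<longrightarrow> v \<in> S"
      using S u by blast
    obtain e where e: "e > 0" "\<forall>v\<in>?W. Wsp_norm s p (v - u) < e \<longrightarrow> v \<in> T"
      using T u by blast
    show "\<exists>e>0. \<forall>v\<in>?W. Wsp_norm s p (v - u) < e \<longrightarrow> v \<in> S \<inter> T"
      using d e by (intro exI[of _ "min d e"]) auto
  qed
  have union: "?P (\<Union>\<K>)" if K: "\<forall>K\<in>\<K>. ?P K" for \<K>
  proof (intro conjI ballI)
    show "\<Union>\<K> \<subseteq> ?W" using K by blast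
    fix u assume "u \<in> \<Union>\<K>"
    then obtain K where Ku: "K \<in> \<K>" "u \<in> K" by blast
    then obtain e where "e > 0" "\<forall>v\<in>?W. Wsp_norm s p (v - u) < e \<longrightarrow> v \<in> K"
      using K by blast
    then show "\<exists>e>0. \<forall>v\<in>?W. Wsp_norm s p (v - u) < e \<longrightarrow> v \<in> \<Union>\<K>"
      using Ku by blast
  qed
  have "istopology ?P"
    unfolding istopology_def using inter union by blast
  then show ?thesis
    by (simp add: Wsp0_topology_def topology_inverse')
qed

lemma topspace_Wsp0_topology [simp]: "topspace (Wsp0_topology \<Omega> s p) = Wsp0_space \<Omega> s p"
proof
  show "topspace (Wsp0_topology \<Omega> s p) \<subseteq> Wsp0_space \<Omega> s p"
    unfolding topspace_def using openin_Wsp0_topology by blast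
  have "openin (Wsp0_topology \<Omega> s p) (Wsp0_space \<Omega> s p)"
    unfolding openin_Wsp0_topology using zero_less_one by blast
  then show "Wsp0_space \<Omega> s p \<subseteq> topspace (Wsp0_topology \<Omega> s p)"
    by (rule openin_subset)
qed

lemma AE_lebesgue_prod:
  fixes P :: "'a::euclidean_space \<Rightarrow> bool"
  assumes "AE x in lebesgue. P x"
  shows "AE z in (lebesgue :: ('a \<times> 'a) measure). P (fst z) \<and> P (snd z)"
proof -
  have "AE x in lborel. P x"
    using assms by (simp add: AE_completion_iff)
  then obtain N where N: "{x \<in> space lborel. \<not> P x} \<subseteq> N" "N \<in> null_sets (lborel :: 'a measure)"
    unfolding eventually_ae_filter by blast
  have null: "N \<times> UNIV \<in> null_sets (lborel \<Otimes>\<^sub>M (lborel :: 'a measure))"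
    "UNIV \<times> N \<in> null_sets (lborel \<Otimes>\<^sub>M (lborel :: 'a measure))"
    using N(2) lborel.times_in_null_sets1[of N lborel UNIV]
      lborel.times_in_null_sets2[of UNIV lborel N] by simp_all
  have "AE z in (lborel \<Otimes>\<^sub>M (lborel :: 'a measure)). P (fst z) \<and> P (snd z)"
    using null_sets.Un[OF null] N(1)
    by (intro AE_I'[of "N \<times> UNIV \<union> UNIV \<times> N"]) auto
  then show ?thesis
    unfolding lborel_prod by (rule AE_completion)
qed

lemma Wsp_norm_AE_eq_zero:
  fixes u v :: "'a::euclidean_space \<Rightarrow> real"
  assumes "AE x in lebesgue. u x = v x"
  shows "Wsp_norm s p (v - u) = 0"
proof -
  have "(LINT x|lebesgue. \<bar>(v - u) x\<bar> powr p) = 0"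
    using assms by (intro integral_eq_zero_AE) (auto elim: eventually_mono)
  moreover have "(LINT z|lebesgue. gagliardo_quotient s p (v - u) z) = 0"
    using AE_lebesgue_prod[OF assms]
    by (intro integral_eq_zero_AE, elim eventually_mono)
      (simp add: gagliardo_quotient_def split_beta)
  ultimately show ?thesis
    by (simp add: Wsp_norm_def Lp_norm_def gagliardo_seminorm_def)
qed

lemma openin_Wsp0_AE_eq:
  assumes "openin (Wsp0_topology \<Omega> s p) U" "u \<in> U" "v \<in> Wsp0_space \<Omega> s p"
    and "AE x in lebesgue. u x = v x"
  shows "v \<in> U"
  using assms(1-3) Wsp_norm_AE_eq_zero[OF assms(4)] unfolding openin_Wsp0_topology by metis

lemma closedin_Wsp0_AE_eq:
  assumes "closedin (Wsp0_topology \<Omega> s p) G" "u \<in> G" "v \<in> Wsp0_space \<Omega> s p"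
    and "AE x in lebesgue. u x = v x"
  shows "v \<in> G"
proof (rule ccontr)
  assume "v \<notin> G"
  moreover have "AE x in lebesgue. v x = u x"
    using assms(4) by (rule eventually_mono) simp
  moreover have "u \<in> Wsp0_space \<Omega> s p"
    using assms(1,2) closedin_subset by fastforce
  ultimately have "u \<in> Wsp0_space \<Omega> s p - G"
    using assms(1,3) openin_Wsp0_AE_eq[of \<Omega> s p "Wsp0_space \<Omega> s p - G" v u]
    by (simp add: closedin_def)
  then show False using assms(2) by blast
qed

lemma continuous_map_Wsp0_AE_eq:
  assumes "continuous_map (subtopology (Wsp0_topology \<Omega> s p) G) Y f" "Hausdorff_space Y"
    and "G \<subseteq> Wsp0_space \<Omega> s p" "u \<in> G" "v \<in> G"
    and "AE x in lebesgue. u x = v x"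
  shows "f u = f v"
proof (rule ccontr)
  let ?X = "subtopology (Wsp0_topology \<Omega> s p) G"
  assume "f u \<noteq> f v"
  moreover have G: "topspace ?X = G"
    using assms(3) by auto
  moreover have "f u \<in> topspace Y" "f v \<in> topspace Y"
    using assms(1,4,5) G unfolding continuous_map_def by auto
  ultimately obtain A B where AB: "openin Y A" "openin Y B" "f u \<in> A" "f v \<in> B" "disjnt A B"
    using assms(2)[unfolded Hausdorff_space_def, rule_format, of "f u" "f v"] by blast
  have "openin ?X {x \<in> topspace ?X. f x \<in> A}"
    using assms(1) AB(1) by (rule openin_continuous_map_preimage)
  then obtain T where T: "openin (Wsp0_topology \<Omega> s p) T" "{x \<in> G. f x \<in> A} = T \<inter> G"
    unfolding openin_subtopology G by blast
  have "u \<in> T" using T AB assms(4) by blast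
  then have "v \<in> T"
    using openin_Wsp0_AE_eq[OF T(1) _ _ assms(6)] assms(3,5) by blast
  then have "f v \<in> A" using T assms(5) by blast
  then show False using AB by (auto simp: disjnt_def)
qed

text \<open>
  \<open>Euclidean_space m\<close> models \<open>\<real>\<^sup>m\<close> by the sequences that vanish from index
  \<open>m\<close> on.  In \<open>enat\<close> the infimum of the empty set is \<open>\<infinity>\<close>.
\<close>

definition krasnoselskii_genus :: "('v::uminus) topology \<Rightarrow> 'v set \<Rightarrow> enat" where
  "krasnoselskii_genus X A = Inf {enat m | m. \<exists>\<phi>.
     continuous_map (subtopology X A) (subtopology (Euclidean_space m) (UNIV - {\<lambda>i. 0})) \<phi> \<and>
     (\<forall>u\<in>A. \<phi> (- u) = - \<phi> u)}"

definition genus_family ::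
    "'a::euclidean_space set \<Rightarrow> real \<Rightarrow> real \<Rightarrow> nat \<Rightarrow> ('a \<Rightarrow> real) set set" where
  "genus_family \<Omega> s p k = {G. G \<noteq> {} \<and> G \<subseteq> Wsp0_space \<Omega> s p \<and> uminus ` G = G \<and>
     closedin (Wsp0_topology \<Omega> s p) G \<and> (\<exists>C. \<forall>u\<in>G. Wsp_norm s p u \<le> C) \<and>
     (\<forall>u\<in>G. Lp_norm p u = 1) \<and>
     enat k \<le> krasnoselskii_genus (Wsp0_topology \<Omega> s p) G}"

definition weighted_seminorm ::
    "('a::euclidean_space \<times> 'a \<Rightarrow> real) \<Rightarrow> real \<Rightarrow> real \<Rightarrow> ('a \<Rightarrow> real) \<Rightarrow> real" where
  "weighted_seminorm a s p v = (LINT z|lebesgue. a z * gagliardo_quotient s p v z) powr (1 / p)"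

text \<open>
  The infimum and the suprema are taken in \<open>[0, \<infinity>]\<close>, which avoids the arbitrary values
  of \<open>Inf\<close> and \<open>Sup\<close> on \<open>real\<close> for empty or unbounded sets.
\<close>

definition minmax_value ::
    "'a::euclidean_space set \<Rightarrow> real \<Rightarrow> real \<Rightarrow> ('a \<times> 'a \<Rightarrow> real) \<Rightarrow> nat \<Rightarrow> ennreal" where
  "minmax_value \<Omega> s p a k =
     (INF G\<in>genus_family \<Omega> s p k. SUP v\<in>G. ennreal (weighted_seminorm a s p v / Lp_norm p v))"

definition Linfty_space :: "'b measure \<Rightarrow> ('b \<Rightarrow> real) set" where
  "Linfty_space M = {f \<in> borel_measurable M. \<exists>C. AE z in M. \<bar>f z\<bar> \<le> C}"

definition weak_star_tendsto_Linfty ::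
    "'b measure \<Rightarrow> (nat \<Rightarrow> 'b \<Rightarrow> real) \<Rightarrow> ('b \<Rightarrow> real) \<Rightarrow> bool" where
  "weak_star_tendsto_Linfty M f g \<longleftrightarrow> (\<forall>h::'b \<Rightarrow> real. integrable M h \<longrightarrow>
     (\<lambda>n. LINT z|M. f n z * h z) \<longlonglongrightarrow> (LINT z|M. g z * h z))"

end

theory Submission
  imports Defs "HOL-Complex_Analysis.Great_Picard"
begin

text \<open>
  The level \<open>\<lambda>\<^sub>k\<close> is governed by the sublevel sets \<open>S\<^sub>n(L)\<close> of \<open>F\<^sub>n\<close> on the unit sphere of
  \<open>L\<^sup>p\<close>.  If a competitor \<open>G\<close> lies in a \<open>\<delta>\<close>-neighbourhood, with respect to the \<open>L\<^sup>p\<close> norm, of a finite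
  set \<open>U\<close> with \<open>F \<le> L\<close> on \<open>U\<close>, then an odd map into the span of \<open>U\<close> carries \<open>G\<close> into
  \<open>{F \<le> L / (1 - \<delta>)}\<close>, so \<open>\<lambda>\<^sub>k \<le> L / (1 - \<delta>)\<close>.  By the compact embedding into \<open>L\<^sup>p\<close> the set
  \<open>S\<^sub>0(L)\<close> has a finite \<open>\<delta>\<close>-net, and \<open>F\<^sub>n \<rightarrow> F\<^sub>0\<close> pointwise on it: this gives the upper bound.  For
  the lower bound, \<open>F\<^sub>0(u) \<le> liminf F\<^sub>n(v\<^sub>n)\<close> whenever \<open>v\<^sub>n \<rightarrow> u\<close> almost everywhere, because the
  functionals involve differences and no derivatives; hence \<open>S\<^sub>n(L)\<close> is eventually contained in a
  neighbourhood of \<open>S\<^sub>0(L)\<close>, and a net of the latter serves the competitors for \<open>F\<^sub>n\<close>.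
\<close>

subsection \<open>Minkowski's inequality\<close>

text \<open>Weak* convergence controls \<open>F\<^sub>n(u)\<close> for each fixed \<open>u\<close>
  only, not uniformly on bounded sets of the fractional space, so competitors, in general infinite
  sets, cannot be compared directly. A finite net leaves finitely many functions to compare. The net
  exists for the L^p norm only, while the genus refers to the stronger topology. This does no harm:
  the odd map has values in a finite-dimensional space, its coefficients are continuous in L^p
  distances, and the energy of an average of net points is bounded by the energies of these points,
  whatever the energy of the averaged element of \<open>G\<close>. Returning to the unit sphere
  costs the factor \<open>1 / (1 - \<delta>)\<close>, because an average within \<delta> of a unit
  vector has norm at least \<open>1 - \<delta>\<close>; \<delta> is chosen from the gap between two
  levels so that this factor is absorbed. Membership in \<open>genus_family\<close> does not involve
  the weight, so a competitor found for one weight may be used for another.\<close>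

lemma powr_convex_combination:
  fixes a b t p :: real
  assumes "1 \<le> p" "0 \<le> a" "0 \<le> b" "0 \<le> t" "t \<le> 1"
  shows "(t * a + (1 - t) * b) powr p \<le> t * a powr p + (1 - t) * b powr p"
proof -
  \<comment> \<open>If one of the two points is 0, the claim reduces to
    \<open>r powr p \<le> r\<close> for \<open>r\<close> in [0,1]. Two positive points are left to
    convexity on the positive half-line.\<close>
  have scale: "(r * x) powr p \<le> r * x powr p" if "0 \<le> r" "r \<le> 1" "0 \<le> x" for r x :: real
  proof -
    have "r powr p \<le> r"
      using that assms(1) powr_mono'[of 1 p r] by (cases "r = 0") auto
    then have "r powr p * x powr p \<le> r * x powr p"
      by (rule mult_right_mono) simp
    then show ?thesis
      using that by (simp add: powr_mult)
  qed
  consider "a = 0" | "b = 0" | "0 < a" "0 < b"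
    using assms by linarith
  then show ?thesis
  proof cases
    case 1
    then show ?thesis
      using scale[of "1 - t" b] assms by simp
  next
    case 2
    then show ?thesis
      using scale[of t a] assms by simp
  next
    case 3
    then show ?thesis
      using powr_convex[OF assms(1), unfolded convex_on_def, THEN conjunct2, rule_format, of a b t "1 - t"]
        assms by simp
  qed
qed

lemma abs_add_powr_le:
  fixes a b p :: real
  assumes "0 \<le> p"
  shows "\<bar>a + b\<bar> powr p \<le> 2 powr p * (\<bar>a\<bar> powr p + \<bar>b\<bar> powr p)"
proof -
  have "\<bar>a + b\<bar> powr p \<le> (2 * max \<bar>a\<bar> \<bar>b\<bar>) powr p"
    using assms by (intro powr_mono2) auto
  also have "\<dots> = 2 powr p * max \<bar>a\<bar> \<bar>b\<bar> powr p"
    by (simp add: powr_mult)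
  also have "\<dots> \<le> 2 powr p * (\<bar>a\<bar> powr p + \<bar>b\<bar> powr p)"
    by (intro mult_left_mono) (auto simp: max_def)
  finally show ?thesis .
qed

text \<open>Applied to a rescaled argument, this takes the place of Hoelder's inequality where an
  L^1 bound on a set of finite measure is drawn from an L^p bound.\<close>

lemma le_one_plus_powr:
  fixes x p :: real
  assumes "1 \<le> p" "0 \<le> x"
  shows "x \<le> 1 + x powr p"
proof (cases "x \<le> 1")
  case True
  then show ?thesis
    by (simp add: add_increasing2)
next
  case False
  then have "x powr 1 \<le> x powr p"
    using assms by (intro powr_mono) auto
  then show ?thesis
    using False by simp
qed

section \<open>Norm and vector space structure of L^p\<close>

lemma Lp_norm_nonneg [simp]: "0 \<le> Lp_norm p u"
  by (simp add: Lp_norm_def)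

lemma Lp_norm_powr:
  assumes "0 < p"
  shows "Lp_norm p u powr p = (LINT x|lebesgue. \<bar>u x\<bar> powr p)"
  using assms by (simp add: Lp_norm_def powr_powr)

lemma Lp_norm_le_iff:
  assumes "0 < p" "0 \<le> c"
  shows "Lp_norm p u \<le> c \<longleftrightarrow> (LINT x|lebesgue. \<bar>u x\<bar> powr p) \<le> c powr p"
  using assms
  by (metis Lp_norm_nonneg Lp_norm_powr linorder_not_less powr_less_mono2 powr_mono2 less_eq_real_def)

lemma Lp_norm_mult:
  assumes "0 < p"
  shows "Lp_norm p (\<lambda>x. c * u x) = \<bar>c\<bar> * Lp_norm p u"
  using assms by (simp add: Lp_norm_def abs_mult powr_mult powr_powr)

lemma Lp_norm_uminus [simp]: "Lp_norm p (- u) = Lp_norm p u"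
  by (simp add: Lp_norm_def)

lemma Lp_norm_minus_commute: "Lp_norm p (u - v) = Lp_norm p (v - u)"
  by (simp add: Lp_norm_def abs_minus_commute)

lemma Lp_norm_zero [simp]: "Lp_norm p (\<lambda>x. 0) = 0"
  by (simp add: Lp_norm_def)

lemma Lp_spaceD:
  assumes "u \<in> Lp_space p"
  shows "u \<in> borel_measurable lebesgue" "integrable lebesgue (\<lambda>x. \<bar>u x\<bar> powr p)"
  using assms by (auto simp: Lp_space_def)

lemma Lp_space_mult:
  assumes "u \<in> Lp_space p"
  shows "(\<lambda>x. c * u x) \<in> Lp_space p"
  using assms by (auto simp: Lp_space_def abs_mult powr_mult)

lemma Lp_space_add:
  assumes "0 \<le> p" "u \<in> Lp_space p" "v \<in> Lp_space p"
  shows "(\<lambda>x. u x + v x) \<in> Lp_space p"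
proof -
  note [measurable] = Lp_spaceD(1)[OF assms(2)] Lp_spaceD(1)[OF assms(3)]
  have "integrable lebesgue (\<lambda>x. 2 powr p * (\<bar>u x\<bar> powr p + \<bar>v x\<bar> powr p))"
    using assms by (auto simp: Lp_space_def)
  then have "integrable lebesgue (\<lambda>x. \<bar>u x + v x\<bar> powr p)"
    by (rule Bochner_Integration.integrable_bound)
      (auto intro!: AE_I2 abs_add_powr_le[OF assms(1)] order_trans[OF _ abs_ge_self])
  then show ?thesis
    by (simp add: Lp_space_def)
qed

text \<open>With \<open>A\<close>, \<open>B\<close> slightly above the two norms, the sum of moduli
  divided by \<open>A + B\<close> is a convex combination of \<open>\<bar>u\<bar> / A\<close> and
  \<open>\<bar>v\<bar> / B\<close>. Convexity of the power bounds its p-th power by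
  \<open>h\<close>, whose integral is at most 1.\<close>

lemma Lp_norm_add_le:
  assumes p: "1 \<le> p" and u: "u \<in> Lp_space p" and v: "v \<in> Lp_space p"
  shows "Lp_norm p (\<lambda>x. u x + v x) \<le> Lp_norm p u + Lp_norm p v"
proof (rule field_le_epsilon)
  fix e :: real assume e: "0 < e"
  \<comment> \<open>The summand \<open>e / 2\<close> keeps both divisors positive, so that a
    vanishing norm is no special case.\<close>
  define A B where "A = Lp_norm p u + e / 2" and "B = Lp_norm p v + e / 2"
  have A: "0 < A" and B: "0 < B" and AB: "A + B = Lp_norm p u + Lp_norm p v + e"
    using e by (auto simp: A_def B_def add_nonneg_pos)
  define t where "t = A / (A + B)"
  have t: "0 \<le> t" "t \<le> 1" "1 - t = B / (A + B)"
    using A B by (auto simp: t_def field_simps)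
  note [measurable] = Lp_spaceD(1)[OF u] Lp_spaceD(1)[OF v]
  define h where "h x = t * (\<bar>u x\<bar> powr p / A powr p) + (1 - t) * (\<bar>v x\<bar> powr p / B powr p)" for x
  have pt: "\<bar>u x + v x\<bar> powr p \<le> (A + B) powr p * h x" for x
  proof -
    have "\<bar>u x + v x\<bar> powr p \<le> (\<bar>u x\<bar> + \<bar>v x\<bar>) powr p"
      using p by (intro powr_mono2) auto
    also have "\<bar>u x\<bar> + \<bar>v x\<bar> = (A + B) * (t * (\<bar>u x\<bar> / A) + (1 - t) * (\<bar>v x\<bar> / B))"
      using A B add_pos_pos[OF A B] unfolding t(3) by (simp add: t_def distrib_left)
    also have "\<dots> powr p = (A + B) powr p * (t * (\<bar>u x\<bar> / A) + (1 - t) * (\<bar>v x\<bar> / B)) powr p"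
      by (rule powr_mult)
    also have "\<dots> \<le> (A + B) powr p * h x"
      using powr_convex_combination[OF p, of "\<bar>u x\<bar> / A" "\<bar>v x\<bar> / B" t] A B t
      by (intro mult_left_mono) (auto simp: h_def powr_divide)
    finally show ?thesis .
  qed
  have uA: "(LINT x|lebesgue. \<bar>u x\<bar> powr p) \<le> A powr p"
    using p e A Lp_norm_le_iff[of p A u] by (simp add: A_def)
  have vB: "(LINT x|lebesgue. \<bar>v x\<bar> powr p) \<le> B powr p"
    using p e B Lp_norm_le_iff[of p B v] by (simp add: B_def)
  have int_h: "integrable lebesgue h"
    unfolding h_def using u v by (auto simp: Lp_space_def)
  have "(LINT x|lebesgue. h x) = t * ((LINT x|lebesgue. \<bar>u x\<bar> powr p) / A powr p)
      + (1 - t) * ((LINT x|lebesgue. \<bar>v x\<bar> powr p) / B powr p)"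
    unfolding h_def using u v by (subst Bochner_Integration.integral_add) (auto simp: Lp_space_def)
  also have "\<dots> \<le> t * 1 + (1 - t) * 1"
    using t uA vB A B by (intro add_mono mult_left_mono) auto
  finally have h1: "(LINT x|lebesgue. h x) \<le> 1"
    by simp
  have "(LINT x|lebesgue. \<bar>u x + v x\<bar> powr p) \<le> (LINT x|lebesgue. (A + B) powr p * h x)"
    using pt int_h Lp_space_add[OF _ u v] p by (intro integral_mono) (auto simp: Lp_space_def)
  also have "\<dots> \<le> (A + B) powr p"
    using h1 by (simp add: mult_left_le)
  finally show "Lp_norm p (\<lambda>x. u x + v x) \<le> Lp_norm p u + Lp_norm p v + e"
    using p A B unfolding AB[symmetric] by (subst Lp_norm_le_iff) auto
qed

lemma Lp_space_diff:
  assumes "0 \<le> p" "u \<in> Lp_space p" "v \<in> Lp_space p"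
  shows "u - v \<in> Lp_space p"
  using Lp_space_add[OF assms(1,2) Lp_space_mult[OF assms(3), of "-1"]]
  by (simp add: fun_diff_def)

lemma Lp_norm_diff_le:
  assumes "1 \<le> p" "u \<in> Lp_space p" "v \<in> Lp_space p"
  shows "\<bar>Lp_norm p u - Lp_norm p v\<bar> \<le> Lp_norm p (u - v)"
proof -
  have *: "Lp_norm p u \<le> Lp_norm p (u - v) + Lp_norm p v"
    if "u \<in> Lp_space p" "v \<in> Lp_space p" for u v
    using Lp_norm_add_le[OF assms(1) Lp_space_diff[OF _ that] that(2)] assms(1) by simp
  show ?thesis
    using *[of u v] *[of v u] assms by (simp add: Lp_norm_minus_commute[of p v u])
qed

lemma Lp_norm_triangle:
  assumes "1 \<le> p" "u \<in> Lp_space p" "v \<in> Lp_space p" "w \<in> Lp_space p"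
  shows "Lp_norm p (u - w) \<le> Lp_norm p (u - v) + Lp_norm p (v - w)"
  using Lp_norm_add_le[OF assms(1) Lp_space_diff[of p u v] Lp_space_diff[of p v w]] assms
  by (simp add: fun_diff_def)

lemma Lp_space_sum:
  assumes "0 \<le> p" "finite I" "\<And>i. i \<in> I \<Longrightarrow> f i \<in> Lp_space p"
  shows "(\<lambda>x. \<Sum>i\<in>I. c i * f i x) \<in> Lp_space p"
  using assms(2,3)
proof (induction I rule: finite_induct)
  case empty
  then show ?case
    by (simp add: Lp_space_def)
next
  case (insert i I)
  then show ?case
    using Lp_space_add[OF assms(1) Lp_space_mult[of "f i" p "c i"]] by simp
qed

lemma Lp_norm_sum_le:
  assumes "1 \<le> p" "finite I" "\<And>i. i \<in> I \<Longrightarrow> f i \<in> Lp_space p"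
  shows "Lp_norm p (\<lambda>x. \<Sum>i\<in>I. c i * f i x) \<le> (\<Sum>i\<in>I. \<bar>c i\<bar> * Lp_norm p (f i))"
  using assms(2,3)
proof (induction I rule: finite_induct)
  case empty
  then show ?case
    by simp
next
  case (insert i I)
  have "Lp_norm p (\<lambda>x. c i * f i x + (\<Sum>i\<in>I. c i * f i x))
      \<le> Lp_norm p (\<lambda>x. c i * f i x) + Lp_norm p (\<lambda>x. \<Sum>i\<in>I. c i * f i x)"
    using insert assms(1) by (intro Lp_norm_add_le Lp_space_mult Lp_space_sum) auto
  with insert assms(1) show ?case
    by (simp add: Lp_norm_mult)
qed

subsection \<open>Weighted Gagliardo seminorms\<close>

text \<open>The target carries the completed sigma-algebra, so beyond Borel measurability preimages
  of null sets must be null. They are products of a null set with the whole space, which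
  \<open>AE_lebesgue_prod\<close> handles.\<close>

lemma measurable_lebesgue_fst_snd:
  shows "fst \<in> (lebesgue :: ('a::euclidean_space \<times> 'a) measure) \<rightarrow>\<^sub>M lebesgue" (is ?fst)
    and "snd \<in> (lebesgue :: ('a::euclidean_space \<times> 'a) measure) \<rightarrow>\<^sub>M lebesgue" (is ?snd)
proof -
  have "fst \<in> (lborel :: ('a \<times> 'a) measure) \<rightarrow>\<^sub>M lborel" "snd \<in> (lborel :: ('a \<times> 'a) measure) \<rightarrow>\<^sub>M lborel"
    by (simp_all add: borel_prod[symmetric])
  then have meas: "fst \<in> (lebesgue :: ('a \<times> 'a) measure) \<rightarrow>\<^sub>M lborel"
    "snd \<in> (lebesgue :: ('a \<times> 'a) measure) \<rightarrow>\<^sub>M lborel"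
    by (simp_all only: measurable_completion)
  have null: "fst -` N \<inter> space lebesgue \<in> null_sets (lebesgue :: ('a \<times> 'a) measure)"
    "snd -` N \<inter> space lebesgue \<in> null_sets (lebesgue :: ('a \<times> 'a) measure)"
    if "N \<in> null_sets lborel" for N
  proof -
    have "AE x in lebesgue. x \<notin> N"
      using that by (intro AE_completion AE_not_in)
    from AE_lebesgue_prod[OF this]
    have "AE z in (lebesgue :: ('a \<times> 'a) measure). z \<notin> fst -` N \<inter> space lebesgue"
      "AE z in (lebesgue :: ('a \<times> 'a) measure). z \<notin> snd -` N \<inter> space lebesgue"
      by (auto elim: eventually_mono)
    then show "fst -` N \<inter> space lebesgue \<in> null_sets (lebesgue :: ('a \<times> 'a) measure)"
      "snd -` N \<inter> space lebesgue \<in> null_sets (lebesgue :: ('a \<times> 'a) measure)"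
      by (simp_all add: completion.null_sets_iff_AE)
  qed
  show ?fst
    using meas null by (intro completion.measurable_completion2) (auto simp: null_sets_distr_iff[OF meas(1)] null_sets_distr_iff[OF meas(2)] intro: null_setsD2[THEN sets_lborel[THEN equalityD1, THEN subsetD]])
  show ?snd
    using meas null by (intro completion.measurable_completion2) (auto simp: null_sets_distr_iff[OF meas(1)] null_sets_distr_iff[OF meas(2)] intro: null_setsD2[THEN sets_lborel[THEN equalityD1, THEN subsetD]])
qed

lemma borel_measurable_lebesgue_fst_snd [measurable (raw)]:
  fixes u :: "'a::euclidean_space \<Rightarrow> 'b::topological_space"
  assumes "u \<in> borel_measurable lebesgue"
  shows "(\<lambda>z. u (fst z)) \<in> borel_measurable (lebesgue :: ('a \<times> 'a) measure)"
    and "(\<lambda>z. u (snd z)) \<in> borel_measurable (lebesgue :: ('a \<times> 'a) measure)"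
  by (auto intro: measurable_compose[OF _ assms] measurable_lebesgue_fst_snd)

lemma borel_measurable_norm_diff_powr [measurable]:
  "(\<lambda>z::'a::euclidean_space \<times> 'a. norm (fst z - snd z) powr r) \<in> borel_measurable lebesgue"
  by (intro measurable_completion) (simp add: borel_prod[symmetric])

lemma borel_measurable_gagliardo_quotient [measurable]:
  fixes u :: "'a::euclidean_space \<Rightarrow> real"
  assumes [measurable]: "u \<in> borel_measurable lebesgue"
  shows "gagliardo_quotient s p u \<in> borel_measurable lebesgue"
  unfolding gagliardo_quotient_def split_beta by measurable

lemma gagliardo_quotient_nonneg [simp]: "0 \<le> gagliardo_quotient s p u z"
  by (simp add: gagliardo_quotient_def split_beta)

text \<open>Positive constants are weights of this kind, so facts about the plain Gagliardo seminorm
  are obtained as the case of weight 1.\<close>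

definition elliptic_weight :: "real \<Rightarrow> real \<Rightarrow> ('b::euclidean_space \<Rightarrow> real) \<Rightarrow> bool" where
  "elliptic_weight \<alpha> \<beta> a \<longleftrightarrow> a \<in> borel_measurable lebesgue \<and> (AE z in lebesgue. \<alpha> \<le> a z \<and> a z \<le> \<beta>)"

text \<open>The truncation \<open>max 0\<close> makes the root meaningful on the null set where the weight may be
  negative.\<close>

definition weighted_difference ::
    "('a::euclidean_space \<times> 'a \<Rightarrow> real) \<Rightarrow> real \<Rightarrow> real \<Rightarrow> ('a \<Rightarrow> real) \<Rightarrow> 'a \<times> 'a \<Rightarrow> real" where
  "weighted_difference a s p v z = max 0 (a z) powr (1 / p) *
     (v (fst z) - v (snd z)) / norm (fst z - snd z) powr ((real DIM('a) + s * p) / p)"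

lemma abs_weighted_difference_powr:
  assumes "0 < p"
  shows "\<bar>weighted_difference a s p v z\<bar> powr p = max 0 (a z) * gagliardo_quotient s p v z"
  using assms
  by (simp add: weighted_difference_def gagliardo_quotient_def split_beta abs_mult powr_mult
      powr_divide powr_powr)

lemma weighted_difference_sum:
  "weighted_difference a s p (\<lambda>x. \<Sum>i\<in>I. c i * f i x) z
     = (\<Sum>i\<in>I. c i * weighted_difference a s p (f i) z)"
  by (simp add: weighted_difference_def sum_subtractf[symmetric] sum_distrib_left sum_divide_distrib
      algebra_simps)

lemma weighted_difference_diff:
  "weighted_difference a s p (u - v) = weighted_difference a s p u - weighted_difference a s p v"
  by (simp add: weighted_difference_def fun_eq_iff diff_divide_distrib[symmetric] algebra_simps)

lemma Wsp_spaceD: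
  assumes "u \<in> Wsp_space s p"
  shows "u \<in> borel_measurable lebesgue" "u \<in> Lp_space p" "integrable lebesgue (gagliardo_quotient s p u)"
  using assms by (auto simp: Wsp_space_def Lp_space_def)

lemma elliptic_weightD:
  assumes "elliptic_weight \<alpha> \<beta> a"
  shows "a \<in> borel_measurable lebesgue" "AE z in lebesgue. \<alpha> \<le> a z \<and> a z \<le> \<beta>"
  using assms by (auto simp: elliptic_weight_def)

lemma integrable_elliptic_mult:
  fixes h :: "'b::euclidean_space \<Rightarrow> real"
  assumes a: "elliptic_weight \<alpha> \<beta> a" and h: "integrable lebesgue h"
  shows "integrable lebesgue (\<lambda>z. a z * h z)"
proof (rule Bochner_Integration.integrable_bound)
  show "integrable lebesgue (\<lambda>z. max \<bar>\<alpha>\<bar> \<bar>\<beta>\<bar> * h z)"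
    using h by simp
  show "(\<lambda>z. a z * h z) \<in> borel_measurable lebesgue"
    using elliptic_weightD(1)[OF a] h by measurable
  show "AE z in lebesgue. norm (a z * h z) \<le> norm (max \<bar>\<alpha>\<bar> \<bar>\<beta>\<bar> * h z)"
    using elliptic_weightD(2)[OF a]
    by (rule eventually_mono) (auto simp: abs_mult intro!: mult_right_mono)
qed

lemma weighted_difference_measurable:
  fixes v :: "'a::euclidean_space \<Rightarrow> real"
  assumes [measurable]: "a \<in> borel_measurable lebesgue" "v \<in> borel_measurable lebesgue"
  shows "weighted_difference a s p v \<in> borel_measurable lebesgue"
  unfolding weighted_difference_def[abs_def] by measurable

lemma weighted_difference_Lp_space:
  assumes "0 < p" "0 \<le> \<alpha>" and a: "elliptic_weight \<alpha> \<beta> a" and v: "v \<in> Wsp_space s p"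
  shows "weighted_difference a s p v \<in> Lp_space p"
proof -
  note [measurable] = elliptic_weightD(1)[OF a] Wsp_spaceD(1)[OF v]
  have "integrable lebesgue (\<lambda>z. max 0 (a z) * gagliardo_quotient s p v z) \<longleftrightarrow>
      integrable lebesgue (\<lambda>z. a z * gagliardo_quotient s p v z)"
    using elliptic_weightD(2)[OF a] assms(2) by (intro integrable_cong_AE) (auto elim!: eventually_mono)
  then show ?thesis
    using integrable_elliptic_mult[OF a Wsp_spaceD(3)[OF v]] assms(1)
    by (simp add: Lp_space_def abs_weighted_difference_powr weighted_difference_measurable)
qed

text \<open>The energy becomes the norm of a function on the product space that depends linearly on
  \<open>v\<close>. As \<open>Lp_norm\<close> is polymorphic, Minkowski's inequality on
  \<open>'a \<times> 'a\<close> then yields the triangle inequality for the weighted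
  seminorm.\<close>

lemma weighted_seminorm_eq_Lp_norm:
  assumes "0 < p" "0 \<le> \<alpha>" and a: "elliptic_weight \<alpha> \<beta> a" and [measurable]: "v \<in> borel_measurable lebesgue"
  shows "weighted_seminorm a s p v = Lp_norm p (weighted_difference a s p v)"
proof -
  note [measurable] = elliptic_weightD(1)[OF a]
  have "(LINT z|lebesgue. a z * gagliardo_quotient s p v z) =
      (LINT z|lebesgue. \<bar>weighted_difference a s p v z\<bar> powr p)"
    unfolding abs_weighted_difference_powr[OF assms(1)]
    using elliptic_weightD(2)[OF a] assms(2) by (intro integral_cong_AE) (auto elim!: eventually_mono)
  then show ?thesis
    by (simp add: weighted_seminorm_def Lp_norm_def)
qed

lemma weighted_seminorm_nonneg [simp]: "0 \<le> weighted_seminorm a s p v"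
  by (simp add: weighted_seminorm_def)

lemma weighted_seminorm_uminus [simp]: "weighted_seminorm a s p (- v) = weighted_seminorm a s p v"
  by (simp add: weighted_seminorm_def gagliardo_quotient_def split_beta abs_minus_commute)

lemma gagliardo_seminorm_eq: "gagliardo_seminorm s p v = weighted_seminorm (\<lambda>z. 1) s p v"
  by (simp add: weighted_seminorm_def gagliardo_seminorm_def)

lemma elliptic_weight_const: "elliptic_weight c c (\<lambda>z. c)"
  by (simp add: elliptic_weight_def)

lemma weighted_seminorm_powr:
  assumes "0 < p" "0 \<le> \<alpha>" and a: "elliptic_weight \<alpha> \<beta> a"
  shows "weighted_seminorm a s p v powr p = (LINT z|lebesgue. a z * gagliardo_quotient s p v z)"
proof -
  have "0 \<le> (LINT z|lebesgue. a z * gagliardo_quotient s p v z)"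
    using elliptic_weightD(2)[OF a] assms(2) by (intro integral_nonneg_AE) (auto elim!: eventually_mono)
  then show ?thesis
    using assms(1) by (simp add: weighted_seminorm_def powr_powr)
qed

lemma weighted_seminorm_le_iff:
  assumes "0 < p" "0 \<le> \<alpha>" and a: "elliptic_weight \<alpha> \<beta> a" and "0 \<le> c"
  shows "weighted_seminorm a s p v \<le> c \<longleftrightarrow> (LINT z|lebesgue. a z * gagliardo_quotient s p v z) \<le> c powr p"
  using assms weighted_seminorm_powr[OF assms(1-3), of s v]
  by (metis weighted_seminorm_nonneg linorder_not_less powr_less_mono2 powr_mono2 less_eq_real_def)

section \<open>Linear structure of the fractional space and triangle inequalities\<close>

lemma Wsp_space_mult:
  assumes "u \<in> Wsp_space s p"
  shows "(\<lambda>x. c * u x) \<in> Wsp_space s p"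
proof -
  have "gagliardo_quotient s p (\<lambda>x. c * u x) = (\<lambda>z. \<bar>c\<bar> powr p * gagliardo_quotient s p u z)"
    by (simp add: gagliardo_quotient_def fun_eq_iff abs_mult powr_mult flip: right_diff_distrib)
  then show ?thesis
    using assms by (simp add: Wsp_space_def Lp_space_mult)
qed

lemma Wsp_spaceI:
  assumes "0 < p" "u \<in> Lp_space p" "weighted_difference (\<lambda>z. 1) s p u \<in> Lp_space p"
  shows "u \<in> Wsp_space s p"
  using assms Lp_spaceD(2)[OF assms(3)] unfolding abs_weighted_difference_powr[OF assms(1)]
  by (simp add: Wsp_space_def)

lemma Wsp_space_sum:
  assumes "0 < p" "finite I" "\<And>i. i \<in> I \<Longrightarrow> f i \<in> Wsp_space s p"
  shows "(\<lambda>x. \<Sum>i\<in>I. c i * f i x) \<in> Wsp_space s p"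
proof (rule Wsp_spaceI[OF assms(1)])
  show "(\<lambda>x. \<Sum>i\<in>I. c i * f i x) \<in> Lp_space p"
    using assms by (intro Lp_space_sum) (auto simp: Wsp_space_def)
  show "weighted_difference (\<lambda>z. 1) s p (\<lambda>x. \<Sum>i\<in>I. c i * f i x) \<in> Lp_space p"
    unfolding weighted_difference_sum[abs_def]
    using assms by (intro Lp_space_sum weighted_difference_Lp_space[OF _ _ elliptic_weight_const]) auto
qed

lemma Wsp_space_diff:
  assumes "0 < p" "u \<in> Wsp_space s p" "v \<in> Wsp_space s p"
  shows "u - v \<in> Wsp_space s p"
  using assms Wsp_spaceD(2)[OF assms(2)] Wsp_spaceD(2)[OF assms(3)]
  by (intro Wsp_spaceI)
    (auto simp: weighted_difference_diff
      intro!: Lp_space_diff weighted_difference_Lp_space[OF _ _ elliptic_weight_const])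

lemma weighted_seminorm_mult:
  assumes "0 < p"
  shows "weighted_seminorm a s p (\<lambda>x. c * u x) = \<bar>c\<bar> * weighted_seminorm a s p u"
proof -
  have "(\<lambda>z. a z * gagliardo_quotient s p (\<lambda>x. c * u x) z) =
      (\<lambda>z. \<bar>c\<bar> powr p * (a z * gagliardo_quotient s p u z))"
    by (simp add: gagliardo_quotient_def fun_eq_iff abs_mult powr_mult flip: right_diff_distrib)
  then show ?thesis
    using assms by (simp add: weighted_seminorm_def powr_mult powr_powr)
qed

lemma weighted_seminorm_sum_le:
  assumes "1 \<le> p" "0 \<le> \<alpha>" and a: "elliptic_weight \<alpha> \<beta> a"
    and "finite I" and f: "\<And>i. i \<in> I \<Longrightarrow> f i \<in> Wsp_space s p"
  shows "weighted_seminorm a s p (\<lambda>x. \<Sum>i\<in>I. c i * f i x)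
    \<le> (\<Sum>i\<in>I. \<bar>c i\<bar> * weighted_seminorm a s p (f i))"
proof -
  have p: "0 < p" using assms(1) by simp
  have eq: "weighted_seminorm a s p v = Lp_norm p (weighted_difference a s p v)"
    if "v \<in> Wsp_space s p" for v
    using weighted_seminorm_eq_Lp_norm[OF p assms(2) a] Wsp_spaceD(1)[OF that] by blast
  have "weighted_seminorm a s p (\<lambda>x. \<Sum>i\<in>I. c i * f i x) =
      Lp_norm p (\<lambda>z. \<Sum>i\<in>I. c i * weighted_difference a s p (f i) z)"
    unfolding weighted_difference_sum[symmetric] by (rule eq[OF Wsp_space_sum[OF p assms(4) f]])
  also have "\<dots> \<le> (\<Sum>i\<in>I. \<bar>c i\<bar> * Lp_norm p (weighted_difference a s p (f i)))"
    by (rule Lp_norm_sum_le[OF assms(1,4) weighted_difference_Lp_space[OF p assms(2) a f]])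
  also have "\<dots> = (\<Sum>i\<in>I. \<bar>c i\<bar> * weighted_seminorm a s p (f i))"
    by (simp add: eq f)
  finally show ?thesis .
qed

lemma weighted_seminorm_diff_le:
  assumes "1 \<le> p" "0 \<le> \<alpha>" and a: "elliptic_weight \<alpha> \<beta> a"
    and u: "u \<in> Wsp_space s p" and v: "v \<in> Wsp_space s p"
  shows "\<bar>weighted_seminorm a s p u - weighted_seminorm a s p v\<bar> \<le> weighted_seminorm a s p (u - v)"
proof -
  have p: "0 < p" using assms(1) by simp
  show ?thesis
    using Lp_norm_diff_le[OF assms(1) weighted_difference_Lp_space[OF p assms(2) a u]
      weighted_difference_Lp_space[OF p assms(2) a v]] Wsp_spaceD(1)[OF u] Wsp_spaceD(1)[OF v]
      Wsp_spaceD(1)[OF Wsp_space_diff[OF p u v]]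
    by (simp add: weighted_seminorm_eq_Lp_norm[OF p assms(2) a] weighted_difference_diff)
qed

text \<open>The constants depend on \<alpha> and \<beta> only. The lower bound therefore makes
  energy bounds uniform along the sequence of weights, and the upper one gives continuity of the
  weighted seminorm in the norm.\<close>

lemma weighted_seminorm_bounds:
  assumes p: "0 < p" and "0 \<le> \<alpha>" and a: "elliptic_weight \<alpha> \<beta> a" and v: "v \<in> Wsp_space s p"
  shows "\<alpha> powr (1 / p) * gagliardo_seminorm s p v \<le> weighted_seminorm a s p v"
    and "weighted_seminorm a s p v \<le> \<beta> powr (1 / p) * gagliardo_seminorm s p v"
proof -
  have int: "integrable lebesgue (\<lambda>z. a z * gagliardo_quotient s p v z)"
    "integrable lebesgue (\<lambda>z. c * gagliardo_quotient s p v z)" for c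
    using integrable_elliptic_mult[OF a] Wsp_spaceD(3)[OF v] by auto
  let ?I = "LINT z|lebesgue. gagliardo_quotient s p v z"
  have I: "0 \<le> ?I" by simp
  have ae: "AE z in lebesgue. \<alpha> * gagliardo_quotient s p v z \<le> a z * gagliardo_quotient s p v z"
    "AE z in lebesgue. a z * gagliardo_quotient s p v z \<le> \<beta> * gagliardo_quotient s p v z"
    using elliptic_weightD(2)[OF a] by (eventually_elim, auto intro: mult_right_mono)+
  have le: "\<alpha> * ?I \<le> (LINT z|lebesgue. a z * gagliardo_quotient s p v z)"
    "(LINT z|lebesgue. a z * gagliardo_quotient s p v z) \<le> \<beta> * ?I"
    unfolding integral_mult_right_zero[symmetric]
    by (intro integral_mono_AE[OF int(2,1) ae(1)] integral_mono_AE[OF int(1,2) ae(2)])+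
  have "(\<alpha> * ?I) powr (1 / p) \<le> weighted_seminorm a s p v"
    unfolding weighted_seminorm_def using le I assms by (intro powr_mono2) auto
  then show "\<alpha> powr (1 / p) * gagliardo_seminorm s p v \<le> weighted_seminorm a s p v"
    by (simp add: gagliardo_seminorm_def powr_mult)
  have "weighted_seminorm a s p v \<le> (\<beta> * ?I) powr (1 / p)"
    unfolding weighted_seminorm_def using le I assms by (intro powr_mono2) (auto intro: order_trans[rotated])
  then show "weighted_seminorm a s p v \<le> \<beta> powr (1 / p) * gagliardo_seminorm s p v"
    by (simp add: gagliardo_seminorm_def powr_mult)
qed

section \<open>Comparison of the fractional Sobolev norm with its two parts\<close>

lemma Wsp_norm_nonneg [simp]: "0 \<le> Wsp_norm s p u"
  by (simp add: Wsp_norm_def)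

lemma gagliardo_seminorm_nonneg [simp]: "0 \<le> gagliardo_seminorm s p u"
  by (simp add: gagliardo_seminorm_def)

lemma Lp_norm_le_Wsp_norm:
  assumes "0 < p"
  shows "Lp_norm p u \<le> Wsp_norm s p u"
proof -
  have "(Lp_norm p u powr p) powr (1 / p) \<le> Wsp_norm s p u"
    unfolding Wsp_norm_def using assms by (intro powr_mono2) auto
  then show ?thesis
    using assms by (simp add: powr_powr)
qed

lemma gagliardo_seminorm_le_Wsp_norm:
  assumes "0 < p"
  shows "gagliardo_seminorm s p u \<le> Wsp_norm s p u"
proof -
  have "(gagliardo_seminorm s p u powr p) powr (1 / p) \<le> Wsp_norm s p u"
    unfolding Wsp_norm_def using assms by (intro powr_mono2) auto
  then show ?thesis
    using assms by (simp add: powr_powr)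
qed

text \<open>Comparison with the sum of the parts replaces a triangle inequality for the combined
  norm. The constant comes from \<open>2 \<le> 2 powr p\<close>.\<close>

lemma Wsp_norm_le:
  assumes "1 \<le> p"
  shows "Wsp_norm s p u \<le> 2 * (Lp_norm p u + gagliardo_seminorm s p u)"
proof -
  let ?A = "Lp_norm p u" and ?B = "gagliardo_seminorm s p u"
  have "?A powr p + ?B powr p \<le> 2 * (?A + ?B) powr p"
    using assms powr_mono2[of p ?A "?A + ?B"] powr_mono2[of p ?B "?A + ?B"] by simp
  also have "\<dots> \<le> 2 powr p * (?A + ?B) powr p"
    using assms powr_mono[of 1 p 2] by (intro mult_right_mono) auto
  also have "\<dots> = (2 * (?A + ?B)) powr p"
    by (rule powr_mult[symmetric])
  finally have "Wsp_norm s p u \<le> ((2 * (?A + ?B)) powr p) powr (1 / p)"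
    unfolding Wsp_norm_def using assms by (intro powr_mono2) auto
  then show ?thesis
    using assms by (simp add: powr_powr)
qed

lemma Wsp_norm_sum_le:
  assumes p: "1 \<le> p" and "finite I" and f: "\<And>i. i \<in> I \<Longrightarrow> f i \<in> Wsp_space s p"
  shows "Wsp_norm s p (\<lambda>x. \<Sum>i\<in>I. c i * f i x)
    \<le> (\<Sum>i\<in>I. \<bar>c i\<bar> * (2 * (Lp_norm p (f i) + gagliardo_seminorm s p (f i))))"
proof -
  have "Lp_norm p (\<lambda>x. \<Sum>i\<in>I. c i * f i x) \<le> (\<Sum>i\<in>I. \<bar>c i\<bar> * Lp_norm p (f i))"
    using Lp_norm_sum_le[OF p assms(2) Wsp_spaceD(2)[OF f]] .
  moreover have "gagliardo_seminorm s p (\<lambda>x. \<Sum>i\<in>I. c i * f i x)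
      \<le> (\<Sum>i\<in>I. \<bar>c i\<bar> * gagliardo_seminorm s p (f i))"
    unfolding gagliardo_seminorm_eq
    by (rule weighted_seminorm_sum_le[OF p _ elliptic_weight_const assms(2) f]) auto
  ultimately show ?thesis
    using Wsp_norm_le[OF p, of s "\<lambda>x. \<Sum>i\<in>I. c i * f i x"]
    by (simp add: sum.distrib distrib_left mult.left_commute[of _ 2] flip: sum_distrib_left)
qed

subsection \<open>Genus of sublevel sets\<close>

lemma Wsp0_spaceD:
  assumes "u \<in> Wsp0_space \<Omega> s p"
  shows "u \<in> Wsp_space s p" "u \<in> Lp_space p" "u \<in> borel_measurable lebesgue"
    "AE x in lebesgue. x \<notin> \<Omega> \<longrightarrow> u x = 0"
  using assms by (auto simp: Wsp0_space_def Wsp_space_def Lp_space_def)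

lemma Wsp0_space_sum:
  assumes "0 < p" "finite I" "\<And>i. i \<in> I \<Longrightarrow> f i \<in> Wsp0_space \<Omega> s p"
  shows "(\<lambda>x. \<Sum>i\<in>I. c i * f i x) \<in> Wsp0_space \<Omega> s p"
proof -
  have "AE x in lebesgue. \<forall>i\<in>I. x \<notin> \<Omega> \<longrightarrow> f i x = 0"
    using assms(2) Wsp0_spaceD(4)[OF assms(3)] by (intro AE_finite_allI) auto
  then have "AE x in lebesgue. x \<notin> \<Omega> \<longrightarrow> (\<Sum>i\<in>I. c i * f i x) = 0"
    by (rule eventually_mono) auto
  then show ?thesis
    using Wsp_space_sum[OF assms(1,2), of f s c] Wsp0_spaceD(1)[OF assms(3)]
    by (simp add: Wsp0_space_def)
qed

lemma Wsp0_space_uminus: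
  assumes "u \<in> Wsp0_space \<Omega> s p"
  shows "- u \<in> Wsp0_space \<Omega> s p"
  using Wsp_space_mult[of u s p "-1"] assms by (auto simp: Wsp0_space_def fun_Compl_def)

section \<open>Continuity for the norm topology\<close>

lemma continuous_map_Wsp0_lipschitz:
  assumes "\<And>u v. u \<in> Wsp0_space \<Omega> s p \<Longrightarrow> v \<in> Wsp0_space \<Omega> s p \<Longrightarrow>
    \<bar>f v - f u\<bar> \<le> c * Wsp_norm s p (v - u)"
  shows "continuous_map (Wsp0_topology \<Omega> s p) euclideanreal f"
  unfolding continuous_map_def
proof (intro conjI allI impI)
  fix V :: "real set" assume "openin euclidean V"
  then have V: "open V" by simp
  show "openin (Wsp0_topology \<Omega> s p) {u \<in> topspace (Wsp0_topology \<Omega> s p). f u \<in> V}"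
    unfolding openin_Wsp0_topology
  proof (intro conjI ballI)
    fix u assume u: "u \<in> {u \<in> topspace (Wsp0_topology \<Omega> s p). f u \<in> V}"
    then obtain e where e: "0 < e" "ball (f u) e \<subseteq> V"
      using V open_contains_ball by blast
    \<comment> \<open>The divisor \<open>\<bar>c\<bar> + 1\<close> is positive whatever the sign of
      \<open>c\<close>.\<close>
    show "\<exists>e>0. \<forall>v\<in>Wsp0_space \<Omega> s p. Wsp_norm s p (v - u) < e \<longrightarrow>
        v \<in> {u \<in> topspace (Wsp0_topology \<Omega> s p). f u \<in> V}"
    proof (intro exI[of _ "e / (\<bar>c\<bar> + 1)"] conjI ballI impI)
      fix v assume v: "v \<in> Wsp0_space \<Omega> s p" "Wsp_norm s p (v - u) < e / (\<bar>c\<bar> + 1)"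
      have "\<bar>f v - f u\<bar> \<le> c * Wsp_norm s p (v - u)"
        using assms[of u v] u v by simp
      also have "\<dots> \<le> (\<bar>c\<bar> + 1) * Wsp_norm s p (v - u)"
        by (intro mult_right_mono) auto
      also have "\<dots> < e"
        using v(2) by (simp add: field_simps)
      finally show "v \<in> {u \<in> topspace (Wsp0_topology \<Omega> s p). f u \<in> V}"
        using e(2) v(1) by (auto simp: subset_iff dist_real_def abs_minus_commute)
    qed (use e in auto)
  qed auto
qed auto

lemma continuous_map_Wsp0_Lp_dist:
  assumes "1 \<le> p" "w \<in> Lp_space p"
  shows "continuous_map (Wsp0_topology \<Omega> s p) euclideanreal (\<lambda>v. Lp_norm p (v - w))"
proof (rule continuous_map_Wsp0_lipschitz[where c = 1])
  fix u v assume uv: "u \<in> Wsp0_space \<Omega> s p" "v \<in> Wsp0_space \<Omega> s p"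
  have "\<bar>Lp_norm p (v - w) - Lp_norm p (u - w)\<bar> \<le> Lp_norm p ((v - w) - (u - w))"
    using uv assms by (intro Lp_norm_diff_le Lp_space_diff) (auto dest: Wsp0_spaceD)
  moreover have "(v - w) - (u - w) = v - u"
    by (simp add: fun_eq_iff)
  ultimately show "\<bar>Lp_norm p (v - w) - Lp_norm p (u - w)\<bar> \<le> 1 * Wsp_norm s p (v - u)"
    using Lp_norm_le_Wsp_norm[of p "v - u" s] assms(1) by simp
qed

lemma continuous_map_Wsp0_Lp_norm:
  assumes "1 \<le> p"
  shows "continuous_map (Wsp0_topology \<Omega> s p) euclideanreal (Lp_norm p)"
  using continuous_map_Wsp0_Lp_dist[OF assms, of "\<lambda>x. 0"] by (simp add: Lp_space_def fun_diff_def)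

lemma continuous_map_Wsp0_weighted_seminorm:
  assumes p: "1 \<le> p" and \<alpha>: "0 \<le> \<alpha>" and a: "elliptic_weight \<alpha> \<beta> a"
  shows "continuous_map (Wsp0_topology \<Omega> s p) euclideanreal (weighted_seminorm a s p)"
proof (rule continuous_map_Wsp0_lipschitz[where c = "\<beta> powr (1 / p)"])
  fix u v assume "u \<in> Wsp0_space \<Omega> s p" "v \<in> Wsp0_space \<Omega> s p"
  then have u: "u \<in> Wsp_space s p" and v: "v \<in> Wsp_space s p"
    by (auto dest: Wsp0_spaceD)
  have "\<bar>weighted_seminorm a s p v - weighted_seminorm a s p u\<bar> \<le> weighted_seminorm a s p (v - u)"
    using weighted_seminorm_diff_le[OF p \<alpha> a v u] .
  also have "\<dots> \<le> \<beta> powr (1 / p) * gagliardo_seminorm s p (v - u)"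
    using weighted_seminorm_bounds(2)[OF _ \<alpha> a Wsp_space_diff[OF _ v u]] p by simp
  also have "\<dots> \<le> \<beta> powr (1 / p) * Wsp_norm s p (v - u)"
    using gagliardo_seminorm_le_Wsp_norm[of p s "v - u"] p by (intro mult_left_mono) auto
  finally show "\<bar>weighted_seminorm a s p v - weighted_seminorm a s p u\<bar>
      \<le> \<beta> powr (1 / p) * Wsp_norm s p (v - u)" .
qed

text \<open>The values lie in the span of finitely many fixed functions, where continuity of the
  scalar coefficients already gives continuity in the strong norm.\<close>

lemma continuous_map_Wsp0_combination:
  assumes p: "1 \<le> p" and I: "finite I" and f: "\<And>i. i \<in> I \<Longrightarrow> f i \<in> Wsp0_space \<Omega> s p"
    and c: "\<And>i. i \<in> I \<Longrightarrow> continuous_map X euclideanreal (c i)"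
  shows "continuous_map X (Wsp0_topology \<Omega> s p) (\<lambda>y x. \<Sum>i\<in>I. c i y * f i x)"
  unfolding continuous_map_def
proof (intro conjI allI impI)
  let ?\<psi> = "\<lambda>y x. \<Sum>i\<in>I. c i y * f i x"
  show "?\<psi> \<in> topspace X \<rightarrow> topspace (Wsp0_topology \<Omega> s p)"
    using Wsp0_space_sum[OF _ I f] p by auto
  fix V assume V: "openin (Wsp0_topology \<Omega> s p) V"
  define M where "M i = 2 * (Lp_norm p (f i) + gagliardo_seminorm s p (f i))" for i
  show "openin X {y \<in> topspace X. ?\<psi> y \<in> V}"
  proof (subst openin_subopen, intro ballI)
    fix y assume y: "y \<in> {y \<in> topspace X. ?\<psi> y \<in> V}"
    then obtain e where e: "0 < e"
      "\<And>v. v \<in> Wsp0_space \<Omega> s p \<Longrightarrow> Wsp_norm s p (v - ?\<psi> y) < e \<Longrightarrow> v \<in> V"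
      using V unfolding openin_Wsp0_topology by blast
    \<comment> \<open>\<open>?g z\<close> majorises the norm distance between the images of
      \<open>z\<close> and \<open>y\<close>; it is continuous in \<open>z\<close> and vanishes at
      \<open>y\<close>.\<close>
    let ?g = "\<lambda>z. \<Sum>i\<in>I. \<bar>c i z - c i y\<bar> * M i"
    have "continuous_map X euclideanreal ?g"
      using I c by (intro continuous_intros) auto
    then have "openin X {z \<in> topspace X. ?g z \<in> {..<e}}"
      by (rule openin_continuous_map_preimage) simp
    moreover have "y \<in> {z \<in> topspace X. ?g z \<in> {..<e}}"
      using y e(1) by simp
    moreover have "{z \<in> topspace X. ?g z \<in> {..<e}} \<subseteq> {y \<in> topspace X. ?\<psi> y \<in> V}"
    proof
      fix z assume "z \<in> {z \<in> topspace X. ?g z \<in> {..<e}}"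
      then have z: "z \<in> topspace X" "?g z < e"
        by auto
      have "?\<psi> z - ?\<psi> y = (\<lambda>x. \<Sum>i\<in>I. (c i z - c i y) * f i x)"
        by (simp add: fun_eq_iff sum_subtractf left_diff_distrib)
      then have "Wsp_norm s p (?\<psi> z - ?\<psi> y) \<le> ?g z"
        using Wsp_norm_sum_le[OF p I, of f s "\<lambda>i. c i z - c i y"] Wsp0_spaceD(1)[OF f]
        by (simp add: M_def)
      then show "z \<in> {y \<in> topspace X. ?\<psi> y \<in> V}"
        using e(2)[of "?\<psi> z"] Wsp0_space_sum[OF _ I f] p z by auto
    qed
    ultimately show "\<exists>T. openin X T \<and> y \<in> T \<and> T \<subseteq> {y \<in> topspace X. ?\<psi> y \<in> V}"
      by blast
  qed
qed

text \<open>An odd map on \<open>B\<close> composed with \<psi> is an odd map on \<open>A\<close>,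
  so every dimension admissible for \<open>B\<close> is admissible for \<open>A\<close>.\<close>

lemma krasnoselskii_genus_le:
  assumes \<psi>: "continuous_map (subtopology X A) (subtopology X B) \<psi>"
    and odd: "\<And>u. u \<in> A \<Longrightarrow> \<psi> u \<in> B \<and> \<psi> (- u) = - \<psi> u"
  shows "krasnoselskii_genus X A \<le> krasnoselskii_genus X B"
  unfolding krasnoselskii_genus_def
proof (rule Inf_superset_mono, safe)
  fix m \<phi>
  assume \<phi>: "continuous_map (subtopology X B) (subtopology (Euclidean_space m) (UNIV - {\<lambda>i. 0})) \<phi>"
    "\<forall>u\<in>B. \<phi> (- u) = - \<phi> u"
  show "\<exists>m'. enat m = enat m' \<and> (\<exists>\<phi>. continuous_map (subtopology X A)
      (subtopology (Euclidean_space m') (UNIV - {\<lambda>i. 0})) \<phi> \<and> (\<forall>u\<in>A. \<phi> (- u) = - \<phi> u))"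
    using continuous_map_compose[OF \<psi> \<phi>(1)] \<phi>(2) odd
    by (intro exI[of _ m] conjI refl exI[of _ "\<phi> \<circ> \<psi>"]) auto
qed

text \<open>The family \<open>G\<close> is mapped by an odd continuous map, built from the distances to the
  points of the net \<open>U\<close>, into the sublevel set \<open>{F \<le> L / (1 - \<delta>)}\<close> of the unit sphere.  This
  sublevel set is itself an admissible competitor, so no compactness of the image is needed.\<close>

lemma minmax_value_le_of_net:
  assumes p: "1 \<le> p" and \<alpha>: "0 < \<alpha>" and a: "elliptic_weight \<alpha> \<beta> a"
    and U: "finite U" "U \<subseteq> Wsp0_space \<Omega> s p" and L: "\<And>u. u \<in> U \<Longrightarrow> weighted_seminorm a s p u \<le> L"
    and G: "G \<in> genus_family \<Omega> s p k" and \<delta>: "0 < \<delta>" "\<delta> < 1"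
    and net: "\<And>v. v \<in> G \<Longrightarrow> \<exists>u\<in>U. Lp_norm p (v - u) < \<delta>"
  shows "minmax_value \<Omega> s p a k \<le> ennreal (L / (1 - \<delta>))"
proof -
  define c where "c = L / (1 - \<delta>)"
  define K where "K = {v \<in> Wsp0_space \<Omega> s p. Lp_norm p v = 1 \<and> weighted_seminorm a s p v \<le> c}"
  have p0: "0 < p" and p0': "0 \<le> p" and \<alpha>': "0 \<le> \<alpha>"
    using p \<alpha> by auto
  have G': "G \<noteq> {}" "G \<subseteq> Wsp0_space \<Omega> s p" "uminus ` G = G" "\<And>u. u \<in> G \<Longrightarrow> Lp_norm p u = 1"
    "enat k \<le> krasnoselskii_genus (Wsp0_topology \<Omega> s p) G"
    using G by (auto simp: genus_family_def)
  obtain u0 where "u0 \<in> U"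
    using G'(1) net by blast
  then have L0: "0 \<le> L"
    using L[of u0] weighted_seminorm_nonneg[of a s p u0] by linarith
  have ULp: "u \<in> Lp_space p" "- u \<in> Lp_space p" if "u \<in> U" for u
    using that U Wsp0_spaceD(2) Wsp0_space_uminus by blast+
  \<comment> \<open>\<open>\<rho> u v\<close> is a cut-off supported where \<open>v\<close> is
    \<delta>-close to \<open>u\<close>. \<open>w v / T v\<close> is the resulting weighted average
    over the points \<open>u\<close> and \<open>- u\<close>; using both signs makes it odd in
    \<open>v\<close>. Dividing \<open>w v\<close> by its own norm \<open>n v\<close> instead puts it
    on the unit sphere.\<close>
  define \<rho> where "\<rho> u v = max 0 (\<delta> - Lp_norm p (v - u))" for u v :: "'a \<Rightarrow> real"
  define b where "b u v = \<rho> u v - \<rho> (- u) v" for u v :: "'a \<Rightarrow> real"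
  define T where "T v = (\<Sum>u\<in>U. \<rho> u v + \<rho> (- u) v)" for v
  define w where "w v = (\<lambda>x. \<Sum>u\<in>U. b u v * u x)" for v
  define n where "n v = Lp_norm p (w v)" for v
  define \<psi> where "\<psi> v = (\<lambda>x. \<Sum>u\<in>U. (b u v / n v) * u x)" for v
  have \<rho>0: "0 \<le> \<rho> u v" for u v
    by (simp add: \<rho>_def)
  have \<rho>_le: "\<rho> u v * Lp_norm p (v - u) \<le> \<rho> u v * \<delta>" for u v
    by (cases "\<delta> \<le> Lp_norm p (v - u)") (auto simp: \<rho>_def intro!: mult_left_mono)
  have \<rho>_minus: "\<rho> u (- v) = \<rho> (- u) v" for u v
  proof -
    have "- v - u = - (v - - u)"
      by (simp add: fun_eq_iff)
    then show ?thesis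
      by (simp only: \<rho>_def Lp_norm_uminus)
  qed
  have w_in: "w v \<in> Wsp0_space \<Omega> s p" for v
    unfolding w_def using U by (intro Wsp0_space_sum p0) auto
  have T_pos: "0 < T v" if v: "v \<in> G" for v
  proof -
    obtain u where u: "u \<in> U" "Lp_norm p (v - u) < \<delta>"
      using net[OF v] by blast
    then have "0 < \<rho> u v + \<rho> (- u) v"
      using \<rho>0[of "- u" v] by (simp add: \<rho>_def)
    then show ?thesis
      unfolding T_def using u U(1) \<rho>0 by (intro sum_pos2[of _ u]) (auto intro: add_nonneg_nonneg)
  qed
  \<comment> \<open>\<open>T v\<close> times \<open>v\<close> minus \<open>w v\<close> is the sum of
    the differences \<open>v - u\<close> and \<open>v + u\<close> weighted by the cut-offs. A
    nonzero cut-off means distance below \<delta>, so this sum has norm at most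
    \<open>T v * \<delta>\<close>, whereas \<open>T v\<close> times \<open>v\<close> has norm
    \<open>T v\<close>.\<close>
  have n_ge: "T v * (1 - \<delta>) \<le> n v" if v: "v \<in> G" for v
  proof -
    have v': "v \<in> Lp_space p"
      using v G'(2) Wsp0_spaceD(2) by blast
    let ?Tv = "\<lambda>x. T v * v x"
    let ?f = "\<lambda>x. \<Sum>u\<in>U. \<rho> u v * (v - u) x" and ?g = "\<lambda>x. \<Sum>u\<in>U. \<rho> (- u) v * (v - - u) x"
    have fg: "?f \<in> Lp_space p" "?g \<in> Lp_space p"
      by (intro Lp_space_sum Lp_space_diff p0' U(1) v' ULp; assumption)+
    have "(\<lambda>x. ?f x + ?g x) = ?Tv - w v"
      unfolding T_def w_def b_def
      by (simp add: fun_eq_iff sum_distrib_right flip: sum.distrib sum_subtractf)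
        (simp add: algebra_simps)
    then have "Lp_norm p (?Tv - w v) \<le> Lp_norm p ?f + Lp_norm p ?g"
      using Lp_norm_add_le[OF p fg] by simp
    also have "\<dots> \<le> (\<Sum>u\<in>U. \<bar>\<rho> u v\<bar> * Lp_norm p (v - u)) + (\<Sum>u\<in>U. \<bar>\<rho> (- u) v\<bar> * Lp_norm p (v - - u))"
      by (intro add_mono Lp_norm_sum_le p U(1) Lp_space_diff p0' v' ULp)
    also have "\<dots> \<le> (\<Sum>u\<in>U. \<rho> u v * \<delta>) + (\<Sum>u\<in>U. \<rho> (- u) v * \<delta>)"
      unfolding abs_of_nonneg[OF \<rho>0] by (intro add_mono sum_mono \<rho>_le)
    also have "\<dots> = T v * \<delta>"
      by (simp add: T_def sum.distrib sum_distrib_right distrib_right)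
    finally have "Lp_norm p (?Tv - w v) \<le> T v * \<delta>" .
    moreover have "Lp_norm p ?Tv = T v"
      using T_pos[OF v] G'(4)[OF v] by (simp add: Lp_norm_mult p0)
    ultimately show ?thesis
      using Lp_norm_diff_le[OF p Lp_space_mult[OF v'] Wsp0_spaceD(2)[OF w_in], of "T v" v]
      by (simp add: n_def algebra_simps)
  qed
  have n_pos: "0 < n v" if "v \<in> G" for v
    using n_ge[OF that] T_pos[OF that] \<delta>(2) by (smt (verit) mult_pos_pos)
  have \<psi>_eq: "\<psi> v = (\<lambda>x. (1 / n v) * w v x)" for v
    by (simp add: \<psi>_def w_def sum_divide_distrib)
  \<comment> \<open>The coefficient \<open>b u v\<close> is bounded by the two cut-offs of
    \<open>u\<close> and \<open>- u\<close> together. The total weight \<open>T v\<close> obtained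
    here cancels against the one in \<open>n_ge\<close>.\<close>
  have Fw: "weighted_seminorm a s p (w v) \<le> T v * L" for v
  proof -
    have "weighted_seminorm a s p (w v) \<le> (\<Sum>u\<in>U. \<bar>b u v\<bar> * weighted_seminorm a s p u)"
      unfolding w_def
      using U by (intro weighted_seminorm_sum_le[OF p \<alpha>' a]) (auto intro: Wsp0_spaceD(1))
    also have "\<dots> \<le> (\<Sum>u\<in>U. (\<rho> u v + \<rho> (- u) v) * L)"
      using L \<rho>0 by (intro sum_mono mult_mono) (auto simp: b_def abs_le_iff add_increasing)
    finally show ?thesis
      by (simp add: T_def sum_distrib_right)
  qed
  have \<psi>_K: "\<psi> v \<in> K" if v: "v \<in> G" for v
  proof -
    have "weighted_seminorm a s p (\<psi> v) = weighted_seminorm a s p (w v) / n v"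
      unfolding \<psi>_eq weighted_seminorm_mult[OF p0] using n_pos[OF v] by simp
    also have "\<dots> \<le> (T v * L) / (T v * (1 - \<delta>))"
      using Fw[of v] n_ge[OF v] T_pos[OF v] \<delta> L0 n_pos[OF v] by (intro frac_le) auto
    also have "\<dots> = c"
      using T_pos[OF v] by (simp add: c_def)
    finally have "weighted_seminorm a s p (\<psi> v) \<le> c" .
    moreover have "Lp_norm p (\<psi> v) = 1"
      unfolding \<psi>_eq Lp_norm_mult[OF p0] using n_pos[OF v] by (simp add: n_def)
    moreover have "\<psi> v \<in> Wsp0_space \<Omega> s p"
      unfolding \<psi>_def using U by (intro Wsp0_space_sum p0) auto
    ultimately show ?thesis
      by (simp add: K_def)
  qed
  let ?XG = "subtopology (Wsp0_topology \<Omega> s p) G"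
  have b_cont: "continuous_map ?XG euclideanreal (b u)" if "u \<in> U" for u
    unfolding b_def \<rho>_def using ULp[OF that]
    by (intro continuous_intros continuous_map_from_subtopology continuous_map_Wsp0_Lp_dist[OF p])
  have "continuous_map ?XG (Wsp0_topology \<Omega> s p) w"
    unfolding w_def[abs_def] using U b_cont by (intro continuous_map_Wsp0_combination[OF p]) auto
  then have n_cont: "continuous_map ?XG euclideanreal n"
    using continuous_map_compose[OF _ continuous_map_Wsp0_Lp_norm[OF p]]
    by (fastforce simp: n_def[abs_def] comp_def)
  have "continuous_map ?XG (Wsp0_topology \<Omega> s p) \<psi>"
    unfolding \<psi>_def[abs_def] using U n_pos
    by (intro continuous_map_Wsp0_combination[OF p] continuous_map_real_divide b_cont n_cont)
      (auto dest!: n_pos)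
  then have "continuous_map ?XG (subtopology (Wsp0_topology \<Omega> s p) K) \<psi>"
    using \<psi>_K by (auto simp: continuous_map_in_subtopology)
  moreover have "\<psi> (- v) = - \<psi> v" for v
  proof -
    have "b u (- v) = - b u v" for u
      using \<rho>_minus[of u v] \<rho>_minus[of "- u" v] by (simp add: b_def fun_Compl_def)
    then have "w (- v) = - w v"
      by (simp add: w_def fun_eq_iff sum_negf)
    then have "n (- v) = n v"
      by (simp add: n_def)
    then show ?thesis
      using \<open>w (- v) = - w v\<close> by (simp add: \<psi>_eq fun_eq_iff)
  qed
  ultimately have "krasnoselskii_genus (Wsp0_topology \<Omega> s p) G
      \<le> krasnoselskii_genus (Wsp0_topology \<Omega> s p) K"
    using \<psi>_K by (intro krasnoselskii_genus_le) auto
  then have genus: "enat k \<le> krasnoselskii_genus (Wsp0_topology \<Omega> s p) K"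
    using G'(5) by (rule order_trans[rotated])
  have "closedin (Wsp0_topology \<Omega> s p)
      ({v \<in> topspace (Wsp0_topology \<Omega> s p). Lp_norm p v \<in> {1}} \<inter>
       {v \<in> topspace (Wsp0_topology \<Omega> s p). weighted_seminorm a s p v \<in> {..c}})"
    by (intro closedin_Int closedin_continuous_map_preimage[OF continuous_map_Wsp0_Lp_norm[OF p]]
        closedin_continuous_map_preimage[OF continuous_map_Wsp0_weighted_seminorm[OF p \<alpha>' a]]) auto
  then have closed: "closedin (Wsp0_topology \<Omega> s p) K"
    by (rule back_subst[of "closedin _"]) (auto simp: K_def)
  \<comment> \<open>Boundedness of \<open>K\<close> in the norm comes from the lower bound \<alpha>
    of the weight.\<close>
  have "Wsp_norm s p v \<le> 2 * (1 + c / \<alpha> powr (1 / p))" if "v \<in> K" for v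
  proof -
    have "\<alpha> powr (1 / p) * gagliardo_seminorm s p v \<le> c"
      using weighted_seminorm_bounds(1)[OF p0 \<alpha>' a, of v s] that Wsp0_spaceD(1)
      by (fastforce simp: K_def)
    then have "gagliardo_seminorm s p v \<le> c / \<alpha> powr (1 / p)"
      using \<alpha> by (simp add: field_simps)
    then show ?thesis
      using Wsp_norm_le[OF p, of s v] that by (simp add: K_def)
  qed
  moreover have "uminus ` K = K"
  proof -
    have "- v \<in> K" if "v \<in> K" for v
      using that Wsp0_space_uminus by (auto simp: K_def)
    then show ?thesis
      by (force simp: fun_Compl_def image_iff)
  qed
  moreover have "K \<noteq> {}"
    using \<psi>_K G'(1) by blast
  moreover have "K \<subseteq> Wsp0_space \<Omega> s p" "\<And>v. v \<in> K \<Longrightarrow> Lp_norm p v = 1"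
    by (auto simp: K_def)
  ultimately have "K \<in> genus_family \<Omega> s p k"
    using closed genus unfolding genus_family_def by blast
  then have "minmax_value \<Omega> s p a k
      \<le> (SUP v\<in>K. ennreal (weighted_seminorm a s p v / Lp_norm p v))"
    unfolding minmax_value_def by (rule INF_lower)
  also have "\<dots> \<le> ennreal c"
    by (rule SUP_least) (simp add: K_def ennreal_leI)
  finally show ?thesis
    by (simp add: c_def)
qed

subsection \<open>Averages over lattice cells\<close>

text \<open>The factor \<open>2\<close>, which Jensen's inequality would remove, allows the elementary bound
  \<open>t \<le> 1 + t powr p\<close>, scaled to the \<open>p\<close>-mean of \<open>f\<close>.\<close>

lemma powr_integral_indicator_le:
  fixes f :: "'b \<Rightarrow> real"
  assumes p: "1 \<le> p" and S: "S \<in> sets M" "emeasure M S < \<infinity>" "0 < measure M S"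
    and f: "f \<in> borel_measurable M" "\<And>x. 0 \<le> f x"
    and int: "integrable M (\<lambda>x. indicator S x * f x powr p)"
  shows "(LINT x|M. indicator S x * f x) powr p
    \<le> 2 powr p * measure M S powr (p - 1) * (LINT x|M. indicator S x * f x powr p)"
proof -
  define \<mu> where "\<mu> = measure M S"
  define I where "I = (LINT x|M. indicator S x * f x powr p)"
  have \<mu>: "0 < \<mu>" using S by (simp add: \<mu>_def)
  have intS: "integrable M (indicator S :: 'b \<Rightarrow> real)"
    using S by simp
  show ?thesis
  proof (cases "I = 0")
    case True
    then have "AE x in M. indicator S x * f x powr p = 0"
      using int unfolding I_def by (subst (asm) integral_nonneg_eq_0_iff_AE) auto
    then have "AE x in M. indicator S x * f x = 0"
      by (rule eventually_mono) auto
    then have "(LINT x|M. indicator S x * f x) = 0"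
      by (intro integral_eq_zero_AE)
    then show ?thesis
      by simp
  next
    case False
    have "0 \<le> I" unfolding I_def by simp
    with False have I: "0 < I" by simp
    \<comment> \<open>\<open>A\<close> is the p-mean of \<open>f\<close> over \<open>S\<close>. At
      this scale the two terms \<open>A * \<mu>\<close> and \<open>A * (I / A powr p)\<close>
      coincide, whence the factor 2; \<open>I = 0\<close> was split off because \<open>A\<close>
      would vanish.\<close>
    define A where "A = (I / \<mu>) powr (1 / p)"
    have A: "0 < A" "A powr p = I / \<mu>"
      using I \<mu> p by (auto simp: A_def powr_powr)
    let ?g = "\<lambda>x. A * (indicator S x + indicator S x * f x powr p / A powr p)"
    have "(LINT x|M. indicator S x * f x) \<le> (LINT x|M. ?g x)"
    proof (rule integral_mono')
      show "integrable M ?g"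
        using int intS by simp
      fix x
      have "f x / A \<le> 1 + (f x / A) powr p"
        using p f(2) A by (intro le_one_plus_powr) auto
      then have "f x \<le> A * (1 + f x powr p / A powr p)"
        using A f(2)[of x] by (simp add: powr_divide field_simps)
      then show "indicator S x * f x \<le> ?g x"
        by (simp add: indicator_def)
      show "0 \<le> ?g x"
        using A(1) by (intro mult_nonneg_nonneg add_nonneg_nonneg divide_nonneg_nonneg) auto
    qed
    also have "(LINT x|M. ?g x) = A * (\<mu> + I / A powr p)"
      using int intS S(1) by (simp add: \<mu>_def I_def)
    also have "\<dots> = 2 * A * \<mu>"
      using A I \<mu> by simp
    finally have "(LINT x|M. indicator S x * f x) powr p \<le> (2 * A * \<mu>) powr p"
      using p f(2) by (intro powr_mono2) auto
    also have "\<dots> = 2 powr p * (A powr p * \<mu> powr p)"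
      by (simp add: powr_mult)
    also have "A powr p * \<mu> powr p = \<mu> powr (p - 1) * I"
      unfolding A using \<mu> by (simp add: powr_diff)
    finally show ?thesis
      by (simp add: \<mu>_def I_def)
  qed
qed

text \<open>For \<open>e > 0\<close> the value is the integer label of the half-open cube of side
  \<open>e\<close> containing \<open>x\<close>; multiplied by \<open>e\<close> it is the lower
  corner. Cells are the fibres of this map, which makes them a partition automatically.\<close>

definition lattice_cell :: "real \<Rightarrow> 'a::euclidean_space \<Rightarrow> 'a" where
  "lattice_cell e x = (\<Sum>b\<in>Basis. of_int \<lfloor>x \<bullet> b / e\<rfloor> *\<^sub>R b)"

lemma lattice_cell_inner: "b \<in> Basis \<Longrightarrow> lattice_cell e x \<bullet> b = of_int \<lfloor>x \<bullet> b / e\<rfloor>"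
  by (simp add: lattice_cell_def)

lemma borel_measurable_lattice_cell [measurable]:
  "lattice_cell e \<in> borel_measurable (borel :: 'a::euclidean_space measure)"
  unfolding lattice_cell_def[abs_def] by measurable

text \<open>Coordinates with equal floors differ by at most \<open>e\<close>; the norm is then
  bounded by the sum of the coordinates, which gives the dimension and not its square root.\<close>

lemma lattice_cell_diameter:
  fixes x y :: "'a::euclidean_space"
  assumes "0 < e" "lattice_cell e x = lattice_cell e y"
  shows "norm (x - y) \<le> e * real DIM('a)"
proof -
  have "\<bar>(x - y) \<bullet> b\<bar> \<le> e" if b: "b \<in> Basis" for b
  proof -
    have "\<lfloor>x \<bullet> b / e\<rfloor> = \<lfloor>y \<bullet> b / e\<rfloor>"
      using arg_cong[OF assms(2), of "\<lambda>z. z \<bullet> b"] b by (simp add: lattice_cell_inner)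
    then have "\<bar>x \<bullet> b / e - y \<bullet> b / e\<bar> \<le> 1"
      by linarith
    then show ?thesis
      using assms(1) by (simp add: inner_diff_left abs_le_iff field_simps)
  qed
  then have "(\<Sum>b\<in>Basis. \<bar>(x - y) \<bullet> b\<bar>) \<le> (\<Sum>b\<in>(Basis::'a set). e)"
    by (rule sum_mono)
  then show ?thesis
    using norm_le_l1[of "x - y"] by (simp add: mult.commute)
qed

text \<open>The half-open cube lies between an open and a closed box of the same volume.\<close>

lemma emeasure_lattice_cell:
  fixes x :: "'a::euclidean_space"
  assumes e: "0 < e"
  shows "emeasure lborel {y. lattice_cell e y = lattice_cell e x} = ennreal (e ^ DIM('a))"
proof -
  let ?Q = "{y. lattice_cell e y = lattice_cell e x}"
  define l u where "l = e *\<^sub>R lattice_cell e x" and "u = e *\<^sub>R (lattice_cell e x + One)"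
  have lu: "l \<bullet> b = e * of_int \<lfloor>x \<bullet> b / e\<rfloor>" "u \<bullet> b = e * (of_int \<lfloor>x \<bullet> b / e\<rfloor> + 1)"
    if "b \<in> Basis" for b
    using that by (auto simp: l_def u_def lattice_cell_inner inner_add_left)
  have meas: "?Q \<in> sets lborel"
    by measurable
  have vol: "(\<Prod>b\<in>Basis. (u - l) \<bullet> b) = e ^ DIM('a)"
    by (simp add: lu inner_diff_left algebra_simps)
  have le: "\<forall>b\<in>Basis. l \<bullet> b \<le> u \<bullet> b"
    using e by (simp add: lu)
  have "box l u \<subseteq> ?Q"
  proof
    fix y assume y: "y \<in> box l u"
    have "\<lfloor>y \<bullet> b / e\<rfloor> = \<lfloor>x \<bullet> b / e\<rfloor>" if b: "b \<in> Basis" for b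
      using y b e by (intro floor_unique) (auto simp: mem_box lu field_simps less_imp_le)
    then show "y \<in> ?Q"
      by (simp add: lattice_cell_def)
  qed
  moreover have "?Q \<subseteq> cbox l u"
  proof
    fix y assume y: "y \<in> ?Q"
    have "l \<bullet> b \<le> y \<bullet> b \<and> y \<bullet> b \<le> u \<bullet> b" if b: "b \<in> Basis" for b
    proof -
      have eq: "\<lfloor>y \<bullet> b / e\<rfloor> = \<lfloor>x \<bullet> b / e\<rfloor>"
        using y b by (metis (mono_tags, lifting) lattice_cell_inner mem_Collect_eq of_int_eq_iff)
      have "of_int \<lfloor>x \<bullet> b / e\<rfloor> \<le> y \<bullet> b / e" "y \<bullet> b / e \<le> of_int \<lfloor>x \<bullet> b / e\<rfloor> + 1"
        unfolding eq[symmetric] by linarith+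
      then show ?thesis
        using e by (simp add: lu[OF b] field_simps)
    qed
    then show "y \<in> cbox l u"
      by (simp add: mem_box)
  qed
  ultimately have "emeasure lborel (box l u) \<le> emeasure lborel ?Q"
    "emeasure lborel ?Q \<le> emeasure lborel (cbox l u)"
    using meas by (auto intro: emeasure_mono)
  then show ?thesis
    using emeasure_lborel_box[of l u] emeasure_lborel_cbox[of l u] le vol
    by (intro antisym) auto
qed

lemma finite_lattice_cell_image:
  fixes \<Omega> :: "'a::euclidean_space set"
  assumes "bounded \<Omega>"
  shows "finite (lattice_cell e ` \<Omega>)"
proof -
  obtain R where R: "\<And>x. x \<in> \<Omega> \<Longrightarrow> norm x \<le> R"
    using assms by (auto simp: bounded_iff)
  define M where "M = \<lceil>R / \<bar>e\<bar>\<rceil> + 1"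
  have "\<lfloor>x \<bullet> b / e\<rfloor> \<in> {- M..M}" if "x \<in> \<Omega>" "b \<in> Basis" for x b
  proof -
    have "\<bar>x \<bullet> b / e\<bar> \<le> R / \<bar>e\<bar>"
      unfolding abs_divide using Basis_le_norm[OF that(2), of x] R[OF that(1)]
      by (intro divide_right_mono) auto
    then show ?thesis
      unfolding M_def atLeastAtMost_iff by linarith
  qed
  then have "lattice_cell e ` \<Omega> \<subseteq> (\<lambda>f. \<Sum>b\<in>Basis. of_int (f b) *\<^sub>R b) ` (PiE Basis (\<lambda>_. {- M..M}))"
    by (force simp: lattice_cell_def intro!: image_eqI[of _ _ "restrict _ Basis"])
  then show ?thesis
    by (rule finite_subset) (intro finite_imageI finite_PiE; simp)
qed

text \<open>A fractional Poincare inequality on cells. Within a cell, \<open>norm (x - y)\<close> is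
  at most \<open>e\<close> times the dimension N, so inserting the singular kernel costs a multiple
  of \<open>e powr (N + s * p)\<close>, while averaging over the cell divides by
  \<open>e powr N\<close>. The remaining \<open>e powr (s * p)\<close> is small for fine
  lattices.\<close>

lemma nn_integral_lattice_mean_le:
  fixes w :: "'a::euclidean_space \<Rightarrow> real"
  assumes p: "1 \<le> p" and s: "0 \<le> s" and e: "0 < e" and w[measurable]: "w \<in> borel_measurable borel"
    and int: "integrable lborel (\<lambda>x. \<bar>w x\<bar> powr p)"
  defines "m \<equiv> \<lambda>z. (LINT y|lborel. indicator {y. lattice_cell e y = z} y * w y) / e ^ DIM('a)"
  shows "(\<integral>\<^sup>+x. ennreal (\<bar>w x - m (lattice_cell e x)\<bar> powr p) \<partial>lborel)
    \<le> ennreal (2 powr p * real DIM('a) powr (real DIM('a) + s * p) * e powr (s * p)) *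
      (\<integral>\<^sup>+z. ennreal (gagliardo_quotient s p w z) \<partial>lborel)"
proof -
  define N where "N = real DIM('a)"
  define V where "V = e ^ DIM('a)"
  define D where "D = (e * N) powr (N + s * p)"
  have V: "0 < V" using e by (simp add: V_def)
  have VN: "V = e powr N" using e by (simp add: V_def N_def powr_realpow)
  have pt: "ennreal (\<bar>w x - m (lattice_cell e x)\<bar> powr p)
      \<le> ennreal (2 powr p / V * D) * (\<integral>\<^sup>+y. ennreal (gagliardo_quotient s p w (x, y)) \<partial>lborel)" for x
  proof -
    let ?Q = "{y. lattice_cell e y = lattice_cell e x}"
    have Q: "?Q \<in> sets lborel" "emeasure lborel ?Q < \<infinity>" "measure lborel ?Q = V"
      using emeasure_lattice_cell[OF e, of x] e
      by (auto simp: V_def measure_def intro: measurable_sets_borel)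
    have ind[measurable]: "(\<lambda>y. indicator ?Q y :: real) \<in> borel_measurable lborel"
      using Q by simp
    have intQ: "integrable lborel (indicator ?Q :: 'a \<Rightarrow> real)"
      using Q by simp
    have int1: "integrable lborel (\<lambda>y. indicator ?Q y * \<bar>w x - w y\<bar> powr p)"
    proof (rule Bochner_Integration.integrable_bound)
      show "integrable lborel (\<lambda>y. 2 powr p * (indicator ?Q y * \<bar>w x\<bar> powr p + \<bar>w y\<bar> powr p))"
        using int intQ by simp
      show "AE y in lborel. norm (indicator ?Q y * \<bar>w x - w y\<bar> powr p)
          \<le> norm (2 powr p * (indicator ?Q y * \<bar>w x\<bar> powr p + \<bar>w y\<bar> powr p))"
        using abs_add_powr_le[of p "w x" "- w y" for y] p by (auto simp: indicator_def)
    qed simp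
    have intw: "integrable lborel (\<lambda>y. indicator ?Q y * w y)"
    proof (rule Bochner_Integration.integrable_bound)
      show "integrable lborel (\<lambda>y. indicator ?Q y + \<bar>w y\<bar> powr p)"
        using int intQ by simp
      show "AE y in lborel. norm (indicator ?Q y * w y) \<le> norm (indicator ?Q y + \<bar>w y\<bar> powr p)"
        using le_one_plus_powr[OF p, of "\<bar>w y\<bar>" for y] by (auto simp: indicator_def)
    qed simp
    \<comment> \<open>The deviation from the mean is the mean over the cell of
      \<open>w x - w y\<close>.\<close>
    have "w x - m (lattice_cell e x) = (LINT y|lborel. indicator ?Q y * (w x - w y)) / V"
      using intw intQ Q V e by (simp add: m_def V_def right_diff_distrib diff_divide_distrib)
    also have "\<bar>\<dots>\<bar> \<le> (LINT y|lborel. indicator ?Q y * \<bar>w x - w y\<bar>) / V"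
      using V integral_abs_bound[of lborel "\<lambda>y. indicator ?Q y * (w x - w y)"]
      by (simp add: abs_mult divide_right_mono)
    finally have "\<bar>w x - m (lattice_cell e x)\<bar> powr p
        \<le> ((LINT y|lborel. indicator ?Q y * \<bar>w x - w y\<bar>) / V) powr p"
      using p by (intro powr_mono2) auto
    also have "\<dots> = (LINT y|lborel. indicator ?Q y * \<bar>w x - w y\<bar>) powr p / V powr p"
      using V by (simp add: powr_divide)
    also have "\<dots> \<le> (2 powr p * V powr (p - 1) *
        (LINT y|lborel. indicator ?Q y * \<bar>w x - w y\<bar> powr p)) / V powr p"
      using powr_integral_indicator_le[OF p Q(1,2), of "\<lambda>y. \<bar>w x - w y\<bar>"] int1 Q(3) V
      by (intro divide_right_mono) auto
    also have "\<dots> = 2 powr p / V * (LINT y|lborel. indicator ?Q y * \<bar>w x - w y\<bar> powr p)"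
      using V by (simp add: powr_diff)
    finally have "ennreal (\<bar>w x - m (lattice_cell e x)\<bar> powr p)
        \<le> ennreal (2 powr p / V) * ennreal (LINT y|lborel. indicator ?Q y * \<bar>w x - w y\<bar> powr p)"
      using V by (simp add: ennreal_leI flip: ennreal_mult)
    also have "ennreal (LINT y|lborel. indicator ?Q y * \<bar>w x - w y\<bar> powr p) =
        (\<integral>\<^sup>+y. ennreal (indicator ?Q y * \<bar>w x - w y\<bar> powr p) \<partial>lborel)"
      using int1 by (intro nn_integral_eq_integral[symmetric]) auto
    also have "\<dots> \<le> (\<integral>\<^sup>+y. ennreal D * ennreal (gagliardo_quotient s p w (x, y)) \<partial>lborel)"
    proof (intro nn_integral_mono)
      fix y
      have "indicator ?Q y * \<bar>w x - w y\<bar> powr p \<le> D * gagliardo_quotient s p w (x, y)"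
      \<comment> \<open>On the diagonal the zero denominator cannot be multiplied back, but there
        the left side is 0.\<close>
      proof (cases "y \<in> ?Q \<and> x \<noteq> y")
        case True
        then have "norm (x - y) powr (N + s * p) \<le> D"
          unfolding D_def using lattice_cell_diameter[OF e, of x y] p s
          by (intro powr_mono2) (auto simp: N_def)
        then have "norm (x - y) powr (N + s * p) * gagliardo_quotient s p w (x, y)
            \<le> D * gagliardo_quotient s p w (x, y)"
          by (intro mult_right_mono) auto
        then show ?thesis
          using True by (simp add: gagliardo_quotient_def N_def)
      next
        case False
        then show ?thesis
          by (auto simp: D_def)
      qed
      then show "ennreal (indicator ?Q y * \<bar>w x - w y\<bar> powr p)
          \<le> ennreal D * ennreal (gagliardo_quotient s p w (x, y))"
        by (simp add: D_def ennreal_leI flip: ennreal_mult)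
    qed
    also have "\<dots> = ennreal D * (\<integral>\<^sup>+y. ennreal (gagliardo_quotient s p w (x, y)) \<partial>lborel)"
      by (intro nn_integral_cmult) (simp add: gagliardo_quotient_def)
    finally have "ennreal (\<bar>w x - m (lattice_cell e x)\<bar> powr p) \<le> ennreal (2 powr p / V) *
        (ennreal D * (\<integral>\<^sup>+y. ennreal (gagliardo_quotient s p w (x, y)) \<partial>lborel))"
      by (simp add: mult_left_mono)
    moreover have "ennreal (2 powr p / V * D) = ennreal (2 powr p / V) * ennreal D"
      using V by (intro ennreal_mult) (auto simp: D_def)
    ultimately show ?thesis
      by (simp add: mult.assoc)
  qed
  have gq: "gagliardo_quotient s p w \<in> borel_measurable (lborel \<Otimes>\<^sub>M lborel)"
    unfolding gagliardo_quotient_def split_beta by measurable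
  have "(\<integral>\<^sup>+x. ennreal (\<bar>w x - m (lattice_cell e x)\<bar> powr p) \<partial>lborel)
      \<le> (\<integral>\<^sup>+x. ennreal (2 powr p / V * D) *
          (\<integral>\<^sup>+y. ennreal (gagliardo_quotient s p w (x, y)) \<partial>lborel) \<partial>lborel)"
    by (intro nn_integral_mono pt)
  also have "\<dots> = ennreal (2 powr p / V * D) *
      (\<integral>\<^sup>+x. \<integral>\<^sup>+y. ennreal (gagliardo_quotient s p w (x, y)) \<partial>lborel \<partial>lborel)"
    using gq by (intro nn_integral_cmult lborel.borel_measurable_nn_integral_fst) simp
  also have "(\<integral>\<^sup>+x. \<integral>\<^sup>+y. ennreal (gagliardo_quotient s p w (x, y)) \<partial>lborel \<partial>lborel) =
      (\<integral>\<^sup>+z. ennreal (gagliardo_quotient s p w z) \<partial>lborel)"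
    unfolding lborel_prod[symmetric] using gq by (intro lborel.nn_integral_fst) simp
  also have "2 powr p / V * D = 2 powr p * N powr (N + s * p) * e powr (s * p)"
    using e unfolding VN D_def by (simp add: powr_mult powr_add)
  finally show ?thesis
    by (simp add: N_def)
qed

lemma countable_range_lattice_cell: "countable (range (lattice_cell e :: 'a::euclidean_space \<Rightarrow> 'a))"
proof -
  have UNIV: "(UNIV :: 'a set) = (\<Union>n::nat. cball 0 (real n))"
  proof -
    have "x \<in> (\<Union>n::nat. cball 0 (real n))" for x :: 'a
      using real_arch_simple[of "norm x"] by auto
    then show ?thesis by blast
  qed
  show ?thesis
    unfolding UNIV image_UN
    by (intro countable_UN[OF countableI_type] countable_finite finite_lattice_cell_image) simp
qed

text \<open>Here \<open>m\<close> is arbitrary: the cell map takes countably many values and is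
  measurable into the discrete sigma-algebra on them.\<close>

lemma measurable_comp_lattice_cell:
  "(\<lambda>x. m (lattice_cell e x)) \<in> borel_measurable (borel :: 'a::euclidean_space measure)"
proof -
  have "lattice_cell e -` {z} \<inter> space borel \<in> sets (borel :: 'a measure)" for z
    by measurable
  then have "lattice_cell e \<in> (borel :: 'a measure) \<rightarrow>\<^sub>M count_space (range (lattice_cell e))"
    by (subst measurable_count_space_eq_countable[OF countable_range_lattice_cell]) auto
  from measurable_compose[OF this, of m borel] show ?thesis
    by simp
qed

text \<open>The quantitative form of the compact embedding: up to a small multiple of the seminorm,
  finitely many linear functionals, the integrals over the cells, control the L^p norm. Boundedness
  of \<Omega> makes their number finite.\<close>

lemma Wsp0_lattice_estimate:
  fixes \<Omega> :: "'a::euclidean_space set"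
  assumes p: "1 \<le> p" and s: "0 < s" and \<Omega>: "bounded \<Omega>" and \<eta>: "0 < \<eta>"
  obtains I :: "'a set" and S :: "'a \<Rightarrow> 'a set" and B :: real
  where "finite I" "\<And>z. z \<in> I \<Longrightarrow> S z \<in> sets borel" "\<And>z. z \<in> I \<Longrightarrow> emeasure lborel (S z) < \<infinity>" "0 \<le> B"
    "\<And>w. w \<in> Wsp0_space \<Omega> s p \<Longrightarrow> Lp_norm p w powr p \<le> \<eta> * gagliardo_seminorm s p w powr p +
      B * (\<Sum>z\<in>I. \<bar>LINT x|lebesgue. indicator (S z) x * w x\<bar> powr p)"
proof -
  define N where "N = real DIM('a)"
  \<comment> \<open>One factor \<open>2 powr p\<close> stems from splitting a function into its cell
    mean and the deviation, the rest from \<open>nn_integral_lattice_mean_le\<close>. The mesh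
    \<open>e\<close> solves \<open>A * e powr (s * p) = \<eta>\<close>.\<close>
  define A where "A = 2 powr p * (2 powr p * N powr (N + s * p))"
  define e where "e = (\<eta> / A) powr (1 / (s * p))"
  have A: "0 < A" by (simp add: A_def N_def)
  have e: "0 < e" using A \<eta> by (simp add: e_def)
  have Ae: "A * e powr (s * p) = \<eta>"
    using A \<eta> s p by (simp add: e_def powr_powr)
  obtain R where R: "\<Omega> \<subseteq> cball 0 R"
    using bounded_subset_ballD[OF \<Omega>, of 0] ball_subset_cball by blast
  define X where "X = cball (0::'a) R"
  define I where "I = lattice_cell e ` X"
  define S where "S z = {y. lattice_cell e y = z}" for z :: 'a
  define V where "V = e ^ DIM('a)"
  \<comment> \<open>The cell means are integrals divided by \<open>V\<close>, and the bound for them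
    is integrated over all of \<open>X\<close>.\<close>
  define B where "B = 2 powr p * measure lborel X * (1 / V) powr p"
  have V: "0 < V" using e by (simp add: V_def)
  have I: "finite I"
    unfolding I_def X_def by (intro finite_lattice_cell_image) simp
  have S: "S z \<in> sets borel" for z
    unfolding S_def by measurable
  have Sfin: "emeasure lborel (S z) < \<infinity>" if "z \<in> I" for z
    using that by (auto simp: I_def S_def emeasure_lattice_cell[OF e])
  have X: "X \<in> sets lborel" "emeasure lborel X < \<infinity>"
    using emeasure_lborel_cball_finite[of 0 R] by (auto simp: X_def)
  have est: "Lp_norm p w powr p \<le> \<eta> * gagliardo_seminorm s p w powr p +
      B * (\<Sum>z\<in>I. \<bar>LINT x|lebesgue. indicator (S z) x * w x\<bar> powr p)"
    if w: "w \<in> Wsp0_space \<Omega> s p" for w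
  proof -
    \<comment> \<open>A Borel representative allows iterated integration over the product of Borel
      measures.\<close>
    obtain w' where w'[measurable]: "w' \<in> borel_measurable lborel" and "AE x in lborel. w x = w' x"
      using completion_ex_borel_measurable_real[OF Wsp0_spaceD(3)[OF w]] by blast
    then have ww': "AE x in lebesgue. w x = w' x"
      by (intro AE_completion)
    have w'b[measurable]: "w' \<in> borel_measurable borel"
      using w' by simp
    have w'l: "w' \<in> borel_measurable lebesgue"
      using w' by (rule measurable_completion)
    note wm = Wsp0_spaceD(3)[OF w]
    have zero: "AE x in lborel. x \<notin> X \<longrightarrow> w' x = 0"
    proof -
      have "AE x in lebesgue. x \<notin> X \<longrightarrow> w' x = 0"
        using ww' Wsp0_spaceD(4)[OF w] by eventually_elim (use R in \<open>auto simp: X_def\<close>)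
      then show ?thesis
        by (simp add: AE_completion_iff)
    qed
    have "integrable lebesgue (\<lambda>x. \<bar>w' x\<bar> powr p)"
      using Lp_spaceD(2)[OF Wsp0_spaceD(2)[OF w]] ww' wm w'l
      by (subst integrable_cong_AE[of _ _ "\<lambda>x. \<bar>w x\<bar> powr p"]) (auto elim!: eventually_mono)
    then have int: "integrable lborel (\<lambda>x. \<bar>w' x\<bar> powr p)"
      by (subst (asm) integrable_completion) auto
    have gq: "(\<integral>\<^sup>+z. ennreal (gagliardo_quotient s p w' z) \<partial>lborel) = ennreal (gagliardo_seminorm s p w powr p)"
    proof -
      have "(\<integral>\<^sup>+z. ennreal (gagliardo_quotient s p w' z) \<partial>lborel) =
          (\<integral>\<^sup>+z. ennreal (gagliardo_quotient s p w z) \<partial>lebesgue)"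
        using AE_lebesgue_prod[OF ww']
        by (subst nn_integral_completion[where M = lborel, symmetric], intro nn_integral_cong_AE, elim eventually_mono)
          (simp add: gagliardo_quotient_def split_beta)
      also have "\<dots> = ennreal (LINT z|lebesgue. gagliardo_quotient s p w z)"
        using Wsp_spaceD(3)[OF Wsp0_spaceD(1)[OF w]] by (intro nn_integral_eq_integral) auto
      finally show ?thesis
        using p by (simp add: gagliardo_seminorm_def powr_powr)
    qed
    define m where "m z = (LINT y|lborel. indicator {y. lattice_cell e y = z} y * w' y) / e ^ DIM('a)" for z
    \<comment> \<open>The sum over all cells bounds the mean of each single cell, hence is a
      constant majorant on \<open>X\<close>.\<close>
    define \<Sigma> where "\<Sigma> = (\<Sum>z\<in>I. \<bar>m z\<bar> powr p)"
    have \<Sigma>0: "0 \<le> \<Sigma>" by (simp add: \<Sigma>_def sum_nonneg)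
    have pt: "ennreal (\<bar>w' x\<bar> powr p) \<le> ennreal (2 powr p) *
        (ennreal (\<bar>w' x - m (lattice_cell e x)\<bar> powr p) + ennreal \<Sigma> * indicator X x)"
      if "x \<notin> X \<longrightarrow> w' x = 0" for x
    proof (cases "x \<in> X")
      case True
      have "\<bar>w' x\<bar> powr p \<le> 2 powr p *
          (\<bar>w' x - m (lattice_cell e x)\<bar> powr p + \<bar>m (lattice_cell e x)\<bar> powr p)"
        using abs_add_powr_le[of p "w' x - m (lattice_cell e x)" "m (lattice_cell e x)"] p by simp
      also have "\<dots> \<le> 2 powr p * (\<bar>w' x - m (lattice_cell e x)\<bar> powr p + \<Sigma>)"
        unfolding \<Sigma>_def using True I
        by (intro mult_left_mono add_left_mono member_le_sum) (auto simp: I_def)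
      finally show ?thesis
        using True \<Sigma>0 by (simp add: ennreal_leI flip: ennreal_mult ennreal_plus)
    next
      case False
      then show ?thesis
        using that p by simp
    qed
    have "Lp_norm p w powr p = (LINT x|lebesgue. \<bar>w' x\<bar> powr p)"
      using p ww' wm w'l Lp_norm_powr[of p w]
      by (auto intro!: integral_cong_AE elim!: eventually_mono)
    also have "\<dots> = (LINT x|lborel. \<bar>w' x\<bar> powr p)"
      by (intro integral_completion) measurable
    finally have "ennreal (Lp_norm p w powr p) = (\<integral>\<^sup>+x. ennreal (\<bar>w' x\<bar> powr p) \<partial>lborel)"
      using int by (simp add: nn_integral_eq_integral)
    also have "\<dots> \<le> (\<integral>\<^sup>+x. ennreal (2 powr p) *
        (ennreal (\<bar>w' x - m (lattice_cell e x)\<bar> powr p) + ennreal \<Sigma> * indicator X x) \<partial>lborel)"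
      using zero by (intro nn_integral_mono_AE) (auto elim!: eventually_mono intro: pt)
    also have "\<dots> = ennreal (2 powr p) *
        ((\<integral>\<^sup>+x. ennreal (\<bar>w' x - m (lattice_cell e x)\<bar> powr p) \<partial>lborel) + ennreal \<Sigma> * emeasure lborel X)"
    proof -
      have [measurable]: "(\<lambda>x. m (lattice_cell e x)) \<in> borel_measurable lborel"
        using measurable_comp_lattice_cell[of m] by simp
      show ?thesis
        using X by (simp add: nn_integral_cmult nn_integral_add nn_integral_cmult_indicator)
    qed
    also have "\<dots> \<le> ennreal (2 powr p) *
        (ennreal (2 powr p * N powr (N + s * p) * e powr (s * p)) * ennreal (gagliardo_seminorm s p w powr p)
         + ennreal \<Sigma> * ennreal (measure lborel X))"
      using nn_integral_lattice_mean_le[OF p less_imp_le[OF s] e w'b int, folded m_def N_def] X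
      by (intro mult_left_mono add_mono) (auto simp: gq emeasure_eq_ennreal_measure)
    also have "\<dots> = ennreal (2 powr p * (2 powr p * N powr (N + s * p) * e powr (s * p) *
        gagliardo_seminorm s p w powr p + \<Sigma> * measure lborel X))"
      using \<Sigma>0 by (simp add: N_def flip: ennreal_mult ennreal_plus)
    finally have le: "Lp_norm p w powr p \<le> 2 powr p * (2 powr p * N powr (N + s * p) * e powr (s * p) *
        gagliardo_seminorm s p w powr p + \<Sigma> * measure lborel X)"
      using \<Sigma>0 by (subst (asm) ennreal_le_iff) (auto simp: N_def)
    have m_eq: "m z = (LINT x|lebesgue. indicator (S z) x * w x) / V" for z
    proof -
      have [measurable]: "(\<lambda>x. indicator (S z) x :: real) \<in> borel_measurable borel"
        using S by simp
      have "(LINT x|lebesgue. indicator (S z) x * w x) = (LINT x|lebesgue. indicator (S z) x * w' x)"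
      proof (rule integral_cong_AE)
        have [measurable]: "(\<lambda>x. indicator (S z) x :: real) \<in> borel_measurable lebesgue"
          by (rule measurable_completion) measurable
        note [measurable] = wm w'l
        show "(\<lambda>x. indicator (S z) x * w x) \<in> borel_measurable lebesgue"
          "(\<lambda>x. indicator (S z) x * w' x) \<in> borel_measurable lebesgue"
          by measurable
        show "AE x in lebesgue. indicator (S z) x * w x = indicator (S z) x * w' x"
          using ww' by (rule eventually_mono) simp
      qed
      also have "\<dots> = (LINT x|lborel. indicator (S z) x * w' x)"
        by (intro integral_completion) measurable
      finally show ?thesis
        by (simp add: m_def V_def S_def)
    qed
    have \<Sigma>: "\<Sigma> = (1 / V) powr p * (\<Sum>z\<in>I. \<bar>LINT x|lebesgue. indicator (S z) x * w x\<bar> powr p)"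
      unfolding \<Sigma>_def m_eq using V by (simp add: sum_distrib_left powr_divide)
    have \<eta>: "2 powr p * (2 powr p * N powr (N + s * p) * e powr (s * p)) = \<eta>"
      using Ae by (simp add: A_def mult.assoc)
    note le
    also have "2 powr p * (2 powr p * N powr (N + s * p) * e powr (s * p) *
        gagliardo_seminorm s p w powr p + \<Sigma> * measure lborel X) =
        (2 powr p * (2 powr p * N powr (N + s * p) * e powr (s * p))) * gagliardo_seminorm s p w powr p +
        2 powr p * measure lborel X * \<Sigma>"
      by (simp add: algebra_simps)
    finally show ?thesis
      unfolding \<eta> \<Sigma> by (simp add: B_def mult.assoc)
  qed
  show thesis
    using that[OF I S Sfin _ est] by (simp add: B_def)
qed

subsection \<open>Compactness in \<open>L\<^sup>p\<close>\<close>

lemma indicator_mult_Lp_bound: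
  fixes w :: "'a::euclidean_space \<Rightarrow> real"
  assumes p: "1 \<le> p" and S: "S \<in> sets borel" "emeasure lborel S < \<infinity>" and w: "w \<in> Lp_space p"
  shows "integrable lebesgue (\<lambda>x. indicator S x * w x)"
    and "\<bar>LINT x|lebesgue. indicator S x * w x\<bar> \<le> measure lebesgue S + Lp_norm p w powr p"
proof -
  have intS: "integrable lebesgue (indicator S :: 'a \<Rightarrow> real)"
    using S by (subst integrable_completion) (auto simp: integrable_indicator_iff)
  note [measurable] = Lp_spaceD(1)[OF w] borel_measurable_integrable[OF intS]
  have int: "integrable lebesgue (\<lambda>x. indicator S x + \<bar>w x\<bar> powr p)"
    using intS Lp_spaceD(2)[OF w] by simp
  have le: "\<bar>indicator S x * w x\<bar> \<le> indicator S x + \<bar>w x\<bar> powr p" for x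
    using le_one_plus_powr[OF p, of "\<bar>w x\<bar>"] by (simp add: indicator_def)
  show int': "integrable lebesgue (\<lambda>x. indicator S x * w x)"
    by (rule Bochner_Integration.integrable_bound[OF int]) (auto intro!: AE_I2 order_trans[OF le])
  have "\<bar>LINT x|lebesgue. indicator S x * w x\<bar> \<le> (LINT x|lebesgue. \<bar>indicator S x * w x\<bar>)"
    by (rule integral_abs_bound)
  also have "\<dots> \<le> (LINT x|lebesgue. indicator S x + \<bar>w x\<bar> powr p)"
    using int int' le by (intro integral_mono) auto
  also have "\<dots> = measure lebesgue S + Lp_norm p w powr p"
    using intS Lp_spaceD(2)[OF w] p S by (simp add: Lp_norm_powr)
  finally show "\<bar>LINT x|lebesgue. indicator S x * w x\<bar> \<le> measure lebesgue S + Lp_norm p w powr p" .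
qed

lemma Wsp0_space_diff:
  assumes "0 < p" "u \<in> Wsp0_space \<Omega> s p" "v \<in> Wsp0_space \<Omega> s p"
  shows "u - v \<in> Wsp0_space \<Omega> s p"
proof -
  have "AE x in lebesgue. x \<notin> \<Omega> \<longrightarrow> (u - v) x = 0"
    using Wsp0_spaceD(4)[OF assms(2)] Wsp0_spaceD(4)[OF assms(3)] by eventually_elim auto
  then show ?thesis
    using Wsp_space_diff[OF assms(1) Wsp0_spaceD(1)[OF assms(2)] Wsp0_spaceD(1)[OF assms(3)]]
    by (simp add: Wsp0_space_def)
qed

lemma gagliardo_seminorm_diff_le:
  assumes p: "1 \<le> p" and u: "u \<in> Wsp_space s p" and v: "v \<in> Wsp_space s p"
  shows "gagliardo_seminorm s p (u - v) \<le> gagliardo_seminorm s p u + gagliardo_seminorm s p v"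
proof -
  \<comment> \<open>The difference is written as a linear combination indexed by the two
    booleans.\<close>
  let ?f = "\<lambda>b. if b then u else v" and ?c = "\<lambda>b. if b then 1 else - 1 :: real"
  have "weighted_seminorm (\<lambda>z. 1) s p (\<lambda>x. \<Sum>b\<in>UNIV. ?c b * ?f b x)
      \<le> (\<Sum>b\<in>UNIV. \<bar>?c b\<bar> * weighted_seminorm (\<lambda>z. 1) s p (?f b))"
    using u v by (intro weighted_seminorm_sum_le[OF p _ elliptic_weight_const]) auto
  then show ?thesis
    by (simp add: UNIV_bool gagliardo_seminorm_eq fun_diff_def)
qed

text \<open>Each accuracy \<open>\<epsilon> j\<close> needs finitely many functionals, all
  accuracies together countably many. A diagonal subsequence makes all of them converge, and the
  lattice estimate turns this into the Cauchy property in L^p.\<close>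

lemma Wsp0_Lp_cauchy_subsequence:
  fixes v :: "nat \<Rightarrow> 'a::euclidean_space \<Rightarrow> real"
  assumes p: "1 \<le> p" and s: "0 < s" and \<Omega>: "bounded \<Omega>"
    and v: "\<And>n. v n \<in> Wsp0_space \<Omega> s p"
    and bound: "\<And>n. Lp_norm p (v n) \<le> C" "\<And>n. gagliardo_seminorm s p (v n) \<le> C"
  obtains k :: "nat \<Rightarrow> nat" where "strict_mono k"
    "\<forall>\<eta>>0. \<exists>M. \<forall>m\<ge>M. \<forall>n\<ge>M. Lp_norm p (v (k m) - v (k n)) powr p < \<eta>"
proof -
  define \<epsilon> where "\<epsilon> j = inverse (real (Suc j))" for j
  define Q where "Q j I S B \<longleftrightarrow> finite I \<and> (\<forall>z\<in>I. S z \<in> sets borel) \<and> (\<forall>z\<in>I. emeasure lborel (S z) < \<infinity>) \<and>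
      0 \<le> B \<and> (\<forall>w\<in>Wsp0_space \<Omega> s p. Lp_norm p w powr p \<le> \<epsilon> j * gagliardo_seminorm s p w powr p +
        B * (\<Sum>z\<in>I. \<bar>LINT x|lebesgue. indicator (S z) x * w x\<bar> powr p))"
    for j and I :: "'a set" and S :: "'a \<Rightarrow> 'a set" and B
  have "\<exists>I S B. Q j I S B" for j
  proof -
    have "0 < \<epsilon> j" by (simp add: \<epsilon>_def)
    then show ?thesis
      unfolding Q_def
      by (rule Wsp0_lattice_estimate[OF p s \<Omega>]) (intro exI conjI ballI; assumption | blast)
  qed
  then obtain I S B where Q: "\<And>j. Q j (I j) (S j) (B j)"
    by metis
  have I: "\<And>j. finite (I j)" and S: "\<And>j z. z \<in> I j \<Longrightarrow> S j z \<in> sets borel"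
      "\<And>j z. z \<in> I j \<Longrightarrow> emeasure lborel (S j z) < \<infinity>"
      and est: "\<And>j w. w \<in> Wsp0_space \<Omega> s p \<Longrightarrow> Lp_norm p w powr p
        \<le> \<epsilon> j * gagliardo_seminorm s p w powr p +
          B j * (\<Sum>z\<in>I j. \<bar>LINT x|lebesgue. indicator (S j z) x * w x\<bar> powr p)"
    using Q unfolding Q_def by blast+
  define l where "l n i = (LINT x|lebesgue. indicator (S (fst i) (snd i)) x * v n x)" for n i
  \<comment> \<open>Division by \<open>D i\<close> gives all functionals the common bound 1 required
    for the diagonal extraction.\<close>
  define D where "D i = measure lebesgue (S (fst i) (snd i)) + C powr p + 1" for i
  have D: "0 < D i" for i
    by (simp add: D_def add_nonneg_pos)
  have "\<bar>l n i\<bar> \<le> D i" if "i \<in> Sigma UNIV I" for n i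
  proof -
    have "\<bar>l n i\<bar> \<le> measure lebesgue (S (fst i) (snd i)) + Lp_norm p (v n) powr p"
      using that S unfolding l_def
      by (intro indicator_mult_Lp_bound(2)[OF p _ _ Wsp0_spaceD(2)[OF v]]) auto
    moreover have "Lp_norm p (v n) powr p \<le> C powr p"
      using bound(1) p by (intro powr_mono2) auto
    ultimately show ?thesis
      by (simp add: D_def)
  qed
  then have "norm (l n i / D i) \<le> 1" if "i \<in> Sigma UNIV I" for n i
    using that D[of i] by (simp add: abs_divide)
  moreover have "countable (Sigma UNIV I)"
    using I by (intro countable_SIGMA[OF countableI_type] countable_finite)
  ultimately obtain k where k: "strict_mono k"
    "\<And>i. i \<in> Sigma UNIV I \<Longrightarrow> \<exists>L. (\<lambda>n. l (k n) i / D i) \<longlonglongrightarrow> L"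
    using function_convergent_subsequence[of "Sigma UNIV I" "\<lambda>n i. l n i / D i" 1] by blast
  have conv: "\<exists>L. (\<lambda>n. l (k n) i) \<longlonglongrightarrow> L" if i: "i \<in> Sigma UNIV I" for i
  proof -
    obtain L where "(\<lambda>n. l (k n) i / D i) \<longlonglongrightarrow> L"
      using k(2)[OF i] by blast
    then have "(\<lambda>n. D i * (l (k n) i / D i)) \<longlonglongrightarrow> D i * L"
      by (intro tendsto_intros)
    then show ?thesis
      using D[of i] by auto
  qed
  have "\<forall>\<eta>>0. \<exists>M. \<forall>m\<ge>M. \<forall>n\<ge>M. Lp_norm p (v (k m) - v (k n)) powr p < \<eta>"
  proof (intro allI impI)
    fix \<eta> :: real assume \<eta>: "0 < \<eta>"
    \<comment> \<open>Differences of the sequence have seminorm at most \<open>2 * C\<close>, so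
      \<open>?G\<close> bounds its p-th power; \<open>?G + 1\<close> is a safe divisor.\<close>
    let ?G = "(2 * C) powr p"
    obtain j where j: "\<epsilon> j < (\<eta> / 2) / (?G + 1)"
      unfolding \<epsilon>_def using \<eta> reals_Archimedean[of "(\<eta> / 2) / (?G + 1)"] by (auto simp: add_nonneg_pos)
    have "\<epsilon> j * ?G \<le> \<epsilon> j * (?G + 1)"
      by (simp add: \<epsilon>_def)
    also have "\<dots> < \<eta> / 2"
    proof -
      have "0 < ?G + 1"
        by (simp add: add_nonneg_pos)
      then show ?thesis
        using j pos_less_divide_eq by blast
    qed
    finally have small: "\<epsilon> j * ?G < \<eta> / 2" .
    obtain L where L: "\<And>z. z \<in> I j \<Longrightarrow> (\<lambda>n. l (k n) (j, z)) \<longlonglongrightarrow> L z"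
      using conv[of "(j, _)"] by (metis SigmaI UNIV_I)
    \<comment> \<open>The product filter lets both indices grow independently; the two limits
      cancel.\<close>
    have "((\<lambda>x. B j * (\<Sum>z\<in>I j. \<bar>l (k (fst x)) (j, z) - l (k (snd x)) (j, z)\<bar> powr p))
        \<longlongrightarrow> B j * (\<Sum>z\<in>I j. \<bar>L z - L z\<bar> powr p)) (sequentially \<times>\<^sub>F sequentially)"
      using p by (intro tendsto_intros filterlim_compose[OF L filterlim_fst]
          filterlim_compose[OF L filterlim_snd] tendsto_powr') auto
    then have "((\<lambda>x. B j * (\<Sum>z\<in>I j. \<bar>l (k (fst x)) (j, z) - l (k (snd x)) (j, z)\<bar> powr p))
        \<longlongrightarrow> 0) (sequentially \<times>\<^sub>F sequentially)"
      by simp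
    then have "\<forall>\<^sub>F x in sequentially \<times>\<^sub>F sequentially.
        B j * (\<Sum>z\<in>I j. \<bar>l (k (fst x)) (j, z) - l (k (snd x)) (j, z)\<bar> powr p) < \<eta> / 2"
      using \<eta> by (intro order_tendstoD) auto
    then obtain M where M: "\<And>m n. M \<le> m \<Longrightarrow> M \<le> n \<Longrightarrow>
        B j * (\<Sum>z\<in>I j. \<bar>l (k m) (j, z) - l (k n) (j, z)\<bar> powr p) < \<eta> / 2"
      unfolding eventually_prod_sequentially by fastforce
    have "Lp_norm p (v (k m) - v (k n)) powr p < \<eta>" if mn: "M \<le> m" "M \<le> n" for m n
    proof -
      let ?w = "v (k m) - v (k n)"
      have w: "?w \<in> Wsp0_space \<Omega> s p"
        using p by (intro Wsp0_space_diff v) auto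
      have "gagliardo_seminorm s p ?w \<le> 2 * C"
        using gagliardo_seminorm_diff_le[OF p Wsp0_spaceD(1)[OF v] Wsp0_spaceD(1)[OF v], of "k m" "k n"]
          bound(2)[of "k m"] bound(2)[of "k n"] by linarith
      then have "gagliardo_seminorm s p ?w powr p \<le> ?G"
        using p by (intro powr_mono2) auto
      then have "\<epsilon> j * gagliardo_seminorm s p ?w powr p \<le> \<epsilon> j * ?G"
        by (intro mult_left_mono) (auto simp: \<epsilon>_def)
      moreover have "(LINT x|lebesgue. indicator (S j z) x * ?w x) = l (k m) (j, z) - l (k n) (j, z)"
        if "z \<in> I j" for z
        using indicator_mult_Lp_bound(1)[OF p S[OF that] Wsp0_spaceD(2)[OF v]]
        by (simp add: l_def right_diff_distrib)
      ultimately show ?thesis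
        using est[OF w, of j] small M[OF mn] by simp
    qed
    then show "\<exists>M. \<forall>m\<ge>M. \<forall>n\<ge>M. Lp_norm p (v (k m) - v (k n)) powr p < \<eta>"
      by blast
  qed
  with k(1) show thesis
    by (rule that)
qed

text \<open>The common bounded support turns the L^p Cauchy property into an L^1 one, which yields
  an almost everywhere convergent subsequence. Fatou's lemma brings the limit back to L^p.\<close>

lemma Lp_cauchy_convergent_subsequence:
  fixes v :: "nat \<Rightarrow> 'a::euclidean_space \<Rightarrow> real"
  assumes p: "1 \<le> p" and \<Omega>: "bounded \<Omega>" and v: "\<And>n. v n \<in> Lp_space p"
    and supp: "\<And>n. AE x in lebesgue. x \<notin> \<Omega> \<longrightarrow> v n x = 0"
    and cauchy: "\<And>\<eta>. 0 < \<eta> \<Longrightarrow> \<exists>M. \<forall>m\<ge>M. \<forall>n\<ge>M. Lp_norm p (v m - v n) powr p < \<eta>"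
  obtains r :: "nat \<Rightarrow> nat" and u where "strict_mono r" "u \<in> Lp_space p"
    "AE x in lebesgue. (\<lambda>n. v (r n) x) \<longlonglongrightarrow> u x" "(\<lambda>n. Lp_norm p (v (r n) - u)) \<longlonglongrightarrow> 0"
proof -
  have p0: "0 < p" using p by simp
  note [measurable] = Lp_spaceD(1)[OF v]
  obtain R where R: "\<Omega> \<subseteq> cball 0 R"
    using bounded_subset_ballD[OF \<Omega>, of 0] ball_subset_cball by blast
  define X where "X = cball (0::'a) R"
  have X: "X \<in> sets borel" "emeasure lborel X < \<infinity>"
    using emeasure_lborel_cball_finite[of 0 R] by (auto simp: X_def)
  have suppX: "AE x in lebesgue. x \<notin> X \<longrightarrow> v n x = 0" for n
    using supp[of n] by eventually_elim (use R in \<open>auto simp: X_def\<close>)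
  have intX: "integrable lebesgue (indicator X :: 'a \<Rightarrow> real)"
    using X by (subst integrable_completion) (auto simp: integrable_indicator_iff)
  have int: "integrable lebesgue (v n)" for n
  proof -
    have "integrable lebesgue (v n) \<longleftrightarrow> integrable lebesgue (\<lambda>x. indicator X x * v n x)"
      using suppX[of n] borel_measurable_integrable[OF indicator_mult_Lp_bound(1)[OF p X v]]
      by (intro integrable_cong_AE) (auto elim!: eventually_mono simp: indicator_def)
    then show ?thesis
      using indicator_mult_Lp_bound(1)[OF p X v] by simp
  qed
  have dLp: "v m - v n \<in> Lp_space p" for m n
    using p by (intro Lp_space_diff v) auto
  have L1: "\<exists>N. \<forall>i\<ge>N. \<forall>j\<ge>N. (LINT x|lebesgue. norm (v i x - v j x)) < e" if e: "0 < e" for e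
  proof -
    \<comment> \<open>In \<open>t \<le> \<eta> + t powr p / \<eta> powr (p - 1)\<close>, integrated
      over \<open>X\<close>, this choice bounds the first term by \<open>e / 2\<close>; the Cauchy
      threshold below is scaled so that the second stays under \<open>e / 2\<close>.\<close>
    define \<eta> where "\<eta> = e / (2 * (measure lebesgue X + 1))"
    have \<eta>: "0 < \<eta>" using e by (simp add: \<eta>_def add_nonneg_pos)
    have "\<eta> * measure lebesgue X \<le> \<eta> * (measure lebesgue X + 1)"
      using \<eta> by simp
    also have "\<dots> = e / 2"
      by (simp add: \<eta>_def field_simps add_nonneg_eq_0_iff)
    finally have small: "\<eta> * measure lebesgue X \<le> e / 2" .
    obtain M where M: "\<And>m n. M \<le> m \<Longrightarrow> M \<le> n \<Longrightarrow> Lp_norm p (v m - v n) powr p < (e / 2) * \<eta> powr (p - 1)"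
      using cauchy[of "(e / 2) * \<eta> powr (p - 1)"] e \<eta> by auto
    have "(LINT x|lebesgue. norm (v i x - v j x)) < e" if ij: "M \<le> i" "M \<le> j" for i j
    proof -
      let ?g = "\<lambda>x. \<eta> * indicator X x + \<bar>(v i - v j) x\<bar> powr p / \<eta> powr (p - 1)"
      have intg: "integrable lebesgue ?g"
        using intX Lp_spaceD(2)[OF dLp] by auto
      have "(LINT x|lebesgue. norm (v i x - v j x)) \<le> (LINT x|lebesgue. ?g x)"
      proof (rule integral_mono_AE)
        show "AE x in lebesgue. norm (v i x - v j x) \<le> ?g x"
          using suppX[of i] suppX[of j]
        proof eventually_elim
          case (elim x)
          show ?case
          proof (cases "x \<in> X")
            case True
            let ?t = "\<bar>v i x - v j x\<bar>"
            have "?t / \<eta> \<le> 1 + (?t / \<eta>) powr p"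
              using \<eta> by (intro le_one_plus_powr p) auto
            then have "?t \<le> \<eta> * (1 + (?t / \<eta>) powr p)"
              using \<eta> by (simp add: field_simps)
            also have "\<dots> = \<eta> + ?t powr p / \<eta> powr (p - 1)"
              using \<eta> by (simp add: powr_divide powr_diff distrib_left)
            finally show ?thesis
              using True by simp
          next
            case False
            then show ?thesis
              using elim by simp
          qed
        qed
      qed (use int intg in auto)
      also have "\<dots> = \<eta> * measure lebesgue X + Lp_norm p (v i - v j) powr p / \<eta> powr (p - 1)"
        using intX Lp_spaceD(2)[OF dLp[of i j]] X p0 by (simp add: Lp_norm_powr)
      also have "\<dots> < e / 2 + e / 2"
        using small M[OF ij] \<eta> by (intro add_le_less_mono) (auto simp: field_simps)
      finally show ?thesis by simp
    qed
    then show ?thesis by blast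
  qed
  obtain r where r: "strict_mono r" "AE x in lebesgue. Cauchy (\<lambda>i. v (r i) x)"
    using cauchy_L1_AE_cauchy_subseq[OF int L1] by blast
  \<comment> \<open>Where the subsequence diverges, \<open>lim\<close> is an unspecified value; this
    concerns a null set only.\<close>
  define u where "u x = lim (\<lambda>i. v (r i) x)" for x
  have u[measurable]: "u \<in> borel_measurable lebesgue"
    unfolding u_def[abs_def] by measurable
  have lim: "AE x in lebesgue. (\<lambda>n. v (r n) x) \<longlonglongrightarrow> u x"
    using r(2) unfolding u_def
    by eventually_elim (simp add: Cauchy_convergent_iff convergent_LIMSEQ_iff)
  \<comment> \<open>Fatou's lemma is applied in the second index, the first being fixed.\<close>
  have fatou: "integrable lebesgue (\<lambda>x. \<bar>(v (r m) - u) x\<bar> powr p) \<and> Lp_norm p (v (r m) - u) powr p \<le> \<eta>"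
    if \<eta>: "0 \<le> \<eta>" and M: "\<And>m n. M \<le> m \<Longrightarrow> M \<le> n \<Longrightarrow> Lp_norm p (v m - v n) powr p \<le> \<eta>"
      and m: "M \<le> m" for M m \<eta>
  proof -
    have le_r: "n \<le> r n" for n
      using r(1) by (rule seq_suble)
    have "(\<integral>\<^sup>+x. ennreal (\<bar>(v (r m) - u) x\<bar> powr p) \<partial>lebesgue)
        = (\<integral>\<^sup>+x. liminf (\<lambda>n. ennreal (\<bar>(v (r m) - v (r n)) x\<bar> powr p)) \<partial>lebesgue)"
    proof (rule nn_integral_cong_AE)
      show "AE x in lebesgue. ennreal (\<bar>(v (r m) - u) x\<bar> powr p)
          = liminf (\<lambda>n. ennreal (\<bar>(v (r m) - v (r n)) x\<bar> powr p))"
        using lim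
      proof eventually_elim
        case (elim x)
        then have "(\<lambda>n. ennreal (\<bar>(v (r m) - v (r n)) x\<bar> powr p)) \<longlonglongrightarrow> ennreal (\<bar>(v (r m) - u) x\<bar> powr p)"
          using p0 by (auto intro!: tendsto_intros tendsto_powr')
        then show ?case
          by (intro lim_imp_Liminf[symmetric]) auto
      qed
    qed
    also have "\<dots> \<le> liminf (\<lambda>n. \<integral>\<^sup>+x. ennreal (\<bar>(v (r m) - v (r n)) x\<bar> powr p) \<partial>lebesgue)"
      by (rule nn_integral_liminf) (simp add: fun_diff_def)
    also have "\<dots> \<le> ennreal \<eta>"
    proof (rule Liminf_le)
      have "(\<integral>\<^sup>+x. ennreal (\<bar>(v (r m) - v (r n)) x\<bar> powr p) \<partial>lebesgue) \<le> ennreal \<eta>" if n: "M \<le> n" for n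
      proof -
        have "(\<integral>\<^sup>+x. ennreal (\<bar>(v (r m) - v (r n)) x\<bar> powr p) \<partial>lebesgue)
            = ennreal (Lp_norm p (v (r m) - v (r n)) powr p)"
          unfolding Lp_norm_powr[OF p0] using Lp_spaceD(2)[OF dLp]
          by (intro nn_integral_eq_integral) auto
        then show ?thesis
          using M[of "r m" "r n"] m n le_r[of m] le_r[of n] by (simp add: ennreal_leI)
      qed
      then show "\<forall>\<^sub>F n in sequentially.
          (\<integral>\<^sup>+x. ennreal (\<bar>(v (r m) - v (r n)) x\<bar> powr p) \<partial>lebesgue) \<le> ennreal \<eta>"
        by (auto simp: eventually_sequentially)
    qed simp
    finally have le: "(\<integral>\<^sup>+x. ennreal (\<bar>(v (r m) - u) x\<bar> powr p) \<partial>lebesgue) \<le> ennreal \<eta>" .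
    have int: "integrable lebesgue (\<lambda>x. \<bar>(v (r m) - u) x\<bar> powr p)"
      by (rule integrableI_bounded) (use le in \<open>auto simp: fun_diff_def intro: le_less_trans\<close>)
    then show ?thesis
      using le \<eta> by (simp add: nn_integral_eq_integral Lp_norm_powr[OF p0])
  qed
  obtain M where M: "\<And>m n. M \<le> m \<Longrightarrow> M \<le> n \<Longrightarrow> Lp_norm p (v m - v n) powr p < 1"
    using cauchy[of 1] by auto
  have "v (r M) - u \<in> Lp_space p"
    using fatou[of 1 M M] M by (simp add: Lp_space_def less_imp_le fun_diff_def)
  from Lp_space_diff[OF _ v[of "r M"] this] have uLp: "u \<in> Lp_space p"
    using p by (simp add: fun_diff_def)
  have "(\<lambda>n. Lp_norm p (v (r n) - u) powr p) \<longlonglongrightarrow> 0"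
  proof (rule LIMSEQ_I)
    fix e :: real assume e: "0 < e"
    obtain M where M: "\<And>m n. M \<le> m \<Longrightarrow> M \<le> n \<Longrightarrow> Lp_norm p (v m - v n) powr p < e / 2"
      using cauchy[of "e / 2"] e by auto
    have "norm (Lp_norm p (v (r n) - u) powr p - 0) < e" if "M \<le> n" for n
      using fatou[of "e / 2" M n] M e that by (simp add: less_imp_le)
    then show "\<exists>no. \<forall>n\<ge>no. norm (Lp_norm p (v (r n) - u) powr p - 0) < e"
      by blast
  qed
  then have "(\<lambda>n. (Lp_norm p (v (r n) - u) powr p) powr (1 / p)) \<longlonglongrightarrow> 0 powr (1 / p)"
    using p0 by (intro tendsto_powr') auto
  then have "(\<lambda>n. Lp_norm p (v (r n) - u)) \<longlonglongrightarrow> 0"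
    using p0 by (simp add: powr_powr)
  with r(1) uLp lim show thesis
    by (rule that)
qed

subsection \<open>Stability under weak* convergence of the weights\<close>

lemma gagliardo_quotient_tendsto:
  assumes "0 < p" "(\<lambda>n. v n (fst z)) \<longlonglongrightarrow> u (fst z)" "(\<lambda>n. v n (snd z)) \<longlonglongrightarrow> u (snd z)"
  shows "(\<lambda>n. gagliardo_quotient s p (v n) z) \<longlonglongrightarrow> gagliardo_quotient s p u z"
  \<comment> \<open>The denominator becomes a constant factor, which is 0 on the diagonal, so no
    nonvanishing condition arises.\<close>
  unfolding gagliardo_quotient_def split_beta divide_inverse
  using assms by (intro tendsto_intros tendsto_powr') auto

text \<open>Along \<open>v n\<close> the quotients are only bounded in \<open>L\<^sup>1\<close>; cutting them off at the quotient of
  the limit \<open>u\<close> gives a dominated sequence that can be paired with the weakly* convergent weights.\<close>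

lemma weighted_seminorm_lsc:
  fixes v :: "nat \<Rightarrow> 'a::euclidean_space \<Rightarrow> real"
  assumes p: "1 \<le> p" and \<alpha>: "0 < \<alpha>" and a: "\<And>n. elliptic_weight \<alpha> \<beta> (a n)" and a0: "elliptic_weight \<alpha> \<beta> a0"
    and weak: "weak_star_tendsto_Linfty lebesgue a a0"
    and v: "\<And>n. v n \<in> Wsp0_space \<Omega> s p" and bound: "\<And>n. weighted_seminorm (a n) s p (v n) \<le> L"
    and lim: "AE x in lebesgue. (\<lambda>n. v n x) \<longlonglongrightarrow> u x" and u: "u \<in> Lp_space p"
  shows "u \<in> Wsp0_space \<Omega> s p" and "weighted_seminorm a0 s p u \<le> L"
proof -
  have p0: "0 < p" using p by simp
  have \<alpha>0: "0 \<le> \<alpha>" using \<alpha> by simp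
  let ?g = "\<lambda>n. gagliardo_quotient s p (v n)" and ?h = "gagliardo_quotient s p u"
  note [measurable] = Lp_spaceD(1)[OF u] Wsp0_spaceD(3)[OF v] elliptic_weightD(1)[OF a]
  have intg: "integrable lebesgue (?g n)" for n
    using Wsp_spaceD(3)[OF Wsp0_spaceD(1)[OF v]] .
  have L0: "0 \<le> L"
    using bound[of 0] weighted_seminorm_nonneg[of "a 0" s p "v 0"] by linarith
  define C where "C = L / \<alpha> powr (1 / p)"
  have C0: "0 \<le> C" using L0 by (simp add: C_def)
  have gC: "(LINT z|lebesgue. ?g n z) \<le> C powr p" for n
  proof -
    have "\<alpha> powr (1 / p) * gagliardo_seminorm s p (v n) \<le> L"
      using weighted_seminorm_bounds(1)[OF p0 \<alpha>0 a[of n] Wsp0_spaceD(1)[OF v[of n]]] bound[of n] by linarith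
    then have "weighted_seminorm (\<lambda>z. 1) s p (v n) \<le> C"
      using \<alpha> by (simp add: C_def field_simps gagliardo_seminorm_eq)
    then show ?thesis
      using weighted_seminorm_le_iff[OF p0 _ elliptic_weight_const[of 1] C0, of s "v n"] by simp
  qed
  have lim_g: "AE z in lebesgue. (\<lambda>n. ?g n z) \<longlonglongrightarrow> ?h z"
    using AE_lebesgue_prod[OF lim] by (rule eventually_mono) (use gagliardo_quotient_tendsto[OF p0] in blast)
  \<comment> \<open>Fatou's lemma with the bound \<open>C\<close>, uniform in \<open>n\<close>,
    shows that the limit has finite seminorm.\<close>
  have "(\<integral>\<^sup>+z. ennreal (?h z) \<partial>lebesgue) = (\<integral>\<^sup>+z. liminf (\<lambda>n. ennreal (?g n z)) \<partial>lebesgue)"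
    using lim_g
    by (intro nn_integral_cong_AE, elim eventually_mono)
      (auto intro!: lim_imp_Liminf[symmetric] tendsto_intros)
  also have "\<dots> \<le> liminf (\<lambda>n. \<integral>\<^sup>+z. ennreal (?g n z) \<partial>lebesgue)"
    by (rule nn_integral_liminf) measurable
  also have "\<dots> \<le> ennreal (C powr p)"
    by (rule Liminf_le) (auto simp: nn_integral_eq_integral[OF intg] intro!: ennreal_leI gC always_eventually)
  finally have "(\<integral>\<^sup>+z. ennreal (?h z) \<partial>lebesgue) \<le> ennreal (C powr p)" .
  then have inth: "integrable lebesgue ?h"
    by (intro integrableI_bounded) (auto intro: le_less_trans)
  have "AE x in lebesgue. \<forall>n. x \<notin> \<Omega> \<longrightarrow> v n x = 0"
    unfolding AE_all_countable using Wsp0_spaceD(4)[OF v] by blast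
  with lim have "AE x in lebesgue. x \<notin> \<Omega> \<longrightarrow> u x = 0"
    by eventually_elim (auto dest: LIMSEQ_unique[OF _ tendsto_const])
  then show "u \<in> Wsp0_space \<Omega> s p"
    using u inth by (simp add: Wsp0_space_def Wsp_space_def)
  define m where "m n z = min (?g n z) (?h z)" for n z
  have intm: "integrable lebesgue (m n)" for n
    unfolding m_def[abs_def] using intg inth by (intro integrable_min)
  have "(\<lambda>n. LINT z|lebesgue. m n z) \<longlonglongrightarrow> (LINT z|lebesgue. ?h z)"
  proof (rule integral_dominated_convergence[where w = ?h])
    show "AE z in lebesgue. (\<lambda>n. m n z) \<longlonglongrightarrow> ?h z"
      using lim_g
    proof eventually_elim
      case (elim z)
      then show ?case
        using tendsto_min[OF elim tendsto_const[of "?h z"]] by (simp add: m_def)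
    qed
  qed (use inth intm in \<open>auto simp: m_def\<close>)
  \<comment> \<open>This minorant of the energy of \<open>v n\<close> comes from
    \<open>a n * ?g n \<ge> a n * m n\<close> and \<open>a n \<le> \<beta>\<close> on the
    nonnegative \<open>?h - m n\<close>. It pairs \<open>a n\<close> with the fixed function
    \<open>?h\<close>, to which weak* convergence applies, and its correction term vanishes by
    dominated convergence.\<close>
  then have "(\<lambda>n. (LINT z|lebesgue. a n z * ?h z) - \<beta> * ((LINT z|lebesgue. ?h z) - (LINT z|lebesgue. m n z)))
      \<longlonglongrightarrow> (LINT z|lebesgue. a0 z * ?h z) - \<beta> * ((LINT z|lebesgue. ?h z) - (LINT z|lebesgue. ?h z))"
    using weak inth unfolding weak_star_tendsto_Linfty_def by (intro tendsto_intros) auto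
  moreover have "(LINT z|lebesgue. a n z * ?h z) - \<beta> * ((LINT z|lebesgue. ?h z) - (LINT z|lebesgue. m n z))
      \<le> L powr p" for n
  proof -
    have "(LINT z|lebesgue. a n z * ?h z) - \<beta> * ((LINT z|lebesgue. ?h z) - (LINT z|lebesgue. m n z))
        = (LINT z|lebesgue. a n z * ?h z - \<beta> * (?h z - m n z))"
      using integrable_elliptic_mult[OF a inth] inth intm by simp
    also have "\<dots> \<le> (LINT z|lebesgue. a n z * ?g n z)"
    proof (rule integral_mono_AE)
      show "AE z in lebesgue. a n z * ?h z - \<beta> * (?h z - m n z) \<le> a n z * ?g n z"
        using elliptic_weightD(2)[OF a[of n]]
      proof eventually_elim
        case (elim z)
        have "a n z * (?h z - m n z) \<le> \<beta> * (?h z - m n z)"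
          using elim by (intro mult_right_mono) (auto simp: m_def)
        moreover have "a n z * m n z \<le> a n z * ?g n z"
          using elim \<alpha> by (intro mult_left_mono) (auto simp: m_def)
        ultimately show ?case
          by (simp add: algebra_simps)
      qed
    qed (use integrable_elliptic_mult[OF a] inth intm intg in auto)
    also have "\<dots> \<le> L powr p"
      using bound[of n] weighted_seminorm_le_iff[OF p0 \<alpha>0 a L0] by blast
    finally show ?thesis .
  qed
  ultimately have "(LINT z|lebesgue. a0 z * ?h z) - \<beta> * ((LINT z|lebesgue. ?h z) - (LINT z|lebesgue. ?h z)) \<le> L powr p"
    by (intro LIMSEQ_le_const2) auto
  then show "weighted_seminorm a0 s p u \<le> L"
    using weighted_seminorm_le_iff[OF p0 \<alpha>0 a0 L0] by simp
qed

section \<open>Compactness and convergence of sublevel sets\<close>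

definition sublevel_sphere ::
    "'a::euclidean_space set \<Rightarrow> real \<Rightarrow> real \<Rightarrow> ('a \<times> 'a \<Rightarrow> real) \<Rightarrow> real \<Rightarrow> ('a \<Rightarrow> real) set" where
  "sublevel_sphere \<Omega> s p a L = {v \<in> Wsp0_space \<Omega> s p. Lp_norm p v = 1 \<and> weighted_seminorm a s p v \<le> L}"

text \<open>For a constant sequence of weights this is compactness of one sublevel set, for varying
  weights it says that the sublevel sets accumulate only at the limit one. Convergence in L^p keeps
  the limit on the unit sphere.\<close>

lemma sublevel_sphere_convergent_subsequence:
  fixes v :: "nat \<Rightarrow> 'a::euclidean_space \<Rightarrow> real"
  assumes p: "1 \<le> p" and s: "0 < s" and \<Omega>: "bounded \<Omega>" and \<alpha>: "0 < \<alpha>"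
    and a: "\<And>n. elliptic_weight \<alpha> \<beta> (a n)" and a0: "elliptic_weight \<alpha> \<beta> a0"
    and weak: "weak_star_tendsto_Linfty lebesgue a a0"
    and v: "\<And>n. v n \<in> sublevel_sphere \<Omega> s p (a n) L"
  obtains r :: "nat \<Rightarrow> nat" and u where "strict_mono r" "u \<in> sublevel_sphere \<Omega> s p a0 L"
    "(\<lambda>n. Lp_norm p (v (r n) - u)) \<longlonglongrightarrow> 0"
proof -
  have p0: "0 < p" and \<alpha>0: "0 \<le> \<alpha>" using p \<alpha> by auto
  have vW: "v n \<in> Wsp0_space \<Omega> s p" and v1: "Lp_norm p (v n) = 1"
    and vL: "weighted_seminorm (a n) s p (v n) \<le> L" for n
    using v[of n] by (auto simp: sublevel_sphere_def)
  define C where "C = max 1 (L / \<alpha> powr (1 / p))"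
  have v_gagliardo: "gagliardo_seminorm s p (v n) \<le> C" for n
  proof -
    have "\<alpha> powr (1 / p) * gagliardo_seminorm s p (v n) \<le> L"
      using weighted_seminorm_bounds(1)[OF p0 \<alpha>0 a[of n] Wsp0_spaceD(1)[OF vW[of n]]] vL[of n] by linarith
    then have "gagliardo_seminorm s p (v n) \<le> L / \<alpha> powr (1 / p)"
      using \<alpha> by (simp add: field_simps)
    then show ?thesis by (simp add: C_def)
  qed
  have v_Lp: "Lp_norm p (v n) \<le> C" for n
    using v1 by (simp add: C_def)
  obtain k :: "nat \<Rightarrow> nat" where k: "strict_mono k"
    "\<forall>\<eta>>0. \<exists>M. \<forall>m\<ge>M. \<forall>n\<ge>M. Lp_norm p (v (k m) - v (k n)) powr p < \<eta>"
    by (rule Wsp0_Lp_cauchy_subsequence[where v = v, OF p s \<Omega> vW v_Lp v_gagliardo])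
  obtain r :: "nat \<Rightarrow> nat" and u where r: "strict_mono r" and u: "u \<in> Lp_space p"
    and lim: "AE x in lebesgue. (\<lambda>n. v (k (r n)) x) \<longlonglongrightarrow> u x"
      "(\<lambda>n. Lp_norm p (v (k (r n)) - u)) \<longlonglongrightarrow> 0"
    by (rule Lp_cauchy_convergent_subsequence[where v = "\<lambda>n. v (k n)",
        OF p \<Omega> Wsp0_spaceD(2)[OF vW] Wsp0_spaceD(4)[OF vW] k(2)[rule_format]])
  have kr: "strict_mono (k \<circ> r)"
    using k(1) r by (rule strict_mono_o)
  have weak': "weak_star_tendsto_Linfty lebesgue (\<lambda>n. a (k (r n))) a0"
    using weak LIMSEQ_subseq_LIMSEQ[OF _ kr]
    unfolding weak_star_tendsto_Linfty_def comp_def by blast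
  note lsc = weighted_seminorm_lsc[where v = "\<lambda>n. v (k (r n))", OF p \<alpha> a a0 weak' vW vL lim(1) u]
  have "(\<lambda>n. 1 - Lp_norm p u) \<longlonglongrightarrow> 0"
  proof (rule tendsto_rabs_zero_cancel, rule tendsto_sandwich[OF _ _ tendsto_const lim(2)])
    show "\<forall>\<^sub>F n in sequentially. \<bar>1 - Lp_norm p u\<bar> \<le> Lp_norm p (v (k (r n)) - u)"
      using Lp_norm_diff_le[OF p Wsp0_spaceD(2)[OF vW] u] v1 by (intro always_eventually) metis
  qed auto
  then have "Lp_norm p u = 1"
    by (simp add: LIMSEQ_const_iff)
  then have "u \<in> sublevel_sphere \<Omega> s p a0 L"
    using lsc by (simp add: sublevel_sphere_def)
  with kr show thesis
    by (rule that) (use lim(2) in simp)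
qed

text \<open>Without a finite net, greedy choice produces an infinite \<delta>-separated sequence,
  which has no L^p convergent subsequence.\<close>

lemma sublevel_sphere_finite_net:
  fixes \<Omega> :: "'a::euclidean_space set"
  assumes p: "1 \<le> p" and s: "0 < s" and \<Omega>: "bounded \<Omega>" and \<alpha>: "0 < \<alpha>"
    and a: "elliptic_weight \<alpha> \<beta> a" and \<delta>: "0 < \<delta>"
  obtains U where "finite U" "U \<subseteq> sublevel_sphere \<Omega> s p a L"
    "\<And>v. v \<in> sublevel_sphere \<Omega> s p a L \<Longrightarrow> \<exists>u\<in>U. Lp_norm p (v - u) < \<delta>"
proof (rule ccontr)
  let ?S = "sublevel_sphere \<Omega> s p a L"
  assume neg: "\<not> thesis"
  note net = that
  have no_net: "\<exists>v\<in>?S. \<forall>u\<in>U. \<delta> \<le> Lp_norm p (v - u)" if U: "finite U" "U \<subseteq> ?S" for U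
    using neg net[OF U] by (meson linorder_not_less)
  have "\<exists>f. \<forall>n::nat. f n \<in> ?S \<and> (\<forall>m<n. \<delta> \<le> Lp_norm p (f n - f m))"
  proof (rule dependent_wellorder_choice)
    fix n :: nat and f assume f: "\<And>m. m < n \<Longrightarrow> f m \<in> ?S \<and> (\<forall>l<m. \<delta> \<le> Lp_norm p (f m - f l))"
    then have "f ` {..<n} \<subseteq> ?S"
      by blast
    then show "\<exists>v. v \<in> ?S \<and> (\<forall>m<n. \<delta> \<le> Lp_norm p (v - f m))"
      using no_net[of "f ` {..<n}"] by auto
  qed auto
  then obtain f :: "nat \<Rightarrow> 'a \<Rightarrow> real"
    where "\<forall>n. f n \<in> ?S \<and> (\<forall>m<n. \<delta> \<le> Lp_norm p (f n - f m))" ..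
  then have f: "\<And>n. f n \<in> ?S" "\<And>m n. m < n \<Longrightarrow> \<delta> \<le> Lp_norm p (f n - f m)"
    by auto
  have weak: "weak_star_tendsto_Linfty lebesgue (\<lambda>n. a) a"
    by (simp add: weak_star_tendsto_Linfty_def)
  obtain r :: "nat \<Rightarrow> nat" and u where r: "strict_mono r" "u \<in> ?S" "(\<lambda>n. Lp_norm p (f (r n) - u)) \<longlonglongrightarrow> 0"
    by (rule sublevel_sphere_convergent_subsequence[OF p s \<Omega> \<alpha> a a weak f(1)])
  have "\<forall>\<^sub>F n in sequentially. Lp_norm p (f (r n) - u) < \<delta> / 2"
    using r(3) \<delta> by (intro order_tendstoD) auto
  then obtain n where n: "Lp_norm p (f (r n) - u) < \<delta> / 2" "Lp_norm p (f (r (Suc n)) - u) < \<delta> / 2"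
    unfolding eventually_sequentially by (meson le_SucI order_refl)
  have in_Lp: "f n \<in> Lp_space p" "u \<in> Lp_space p" for n
    using f(1)[of n] r(2) Wsp0_spaceD(2) by (auto simp: sublevel_sphere_def)
  have "\<delta> \<le> Lp_norm p (f (r (Suc n)) - f (r n))"
    using r(1) by (intro f(2)) (simp add: strict_mono_Suc_iff)
  also have "\<dots> \<le> Lp_norm p (f (r (Suc n)) - u) + Lp_norm p (u - f (r n))"
    by (intro Lp_norm_triangle p in_Lp)
  also have "\<dots> < \<delta>"
    using n by (simp add: Lp_norm_minus_commute[of p u])
  finally show False by simp
qed

text \<open>One half of Hausdorff convergence in L^p. Functions violating it along a subsequence of
  weights would accumulate at a point of the limit sublevel set.\<close>

lemma eventually_sublevel_sphere_near:
  fixes \<Omega> :: "'a::euclidean_space set"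
  assumes p: "1 \<le> p" and s: "0 < s" and \<Omega>: "bounded \<Omega>" and \<alpha>: "0 < \<alpha>"
    and a: "\<And>n. elliptic_weight \<alpha> \<beta> (a n)" and a0: "elliptic_weight \<alpha> \<beta> a0"
    and weak: "weak_star_tendsto_Linfty lebesgue a a0" and \<delta>: "0 < \<delta>"
  shows "\<forall>\<^sub>F n in sequentially. \<forall>v\<in>sublevel_sphere \<Omega> s p (a n) L.
    \<exists>u\<in>sublevel_sphere \<Omega> s p a0 L. Lp_norm p (v - u) < \<delta>"
proof (rule ccontr)
  assume "\<not> ?thesis"
  then obtain r where r: "strict_mono (r :: nat \<Rightarrow> nat)"
    "\<And>n. \<exists>v\<in>sublevel_sphere \<Omega> s p (a (r n)) L. \<forall>u\<in>sublevel_sphere \<Omega> s p a0 L. \<delta> \<le> Lp_norm p (v - u)"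
    by (auto dest!: not_eventually_sequentiallyD simp: not_less)
  then obtain v where v: "\<And>n. v n \<in> sublevel_sphere \<Omega> s p (a (r n)) L"
    "\<And>n u. u \<in> sublevel_sphere \<Omega> s p a0 L \<Longrightarrow> \<delta> \<le> Lp_norm p (v n - u)"
    by metis
  have weak': "weak_star_tendsto_Linfty lebesgue (\<lambda>n. a (r n)) a0"
    using weak LIMSEQ_subseq_LIMSEQ[OF _ r(1)]
    unfolding weak_star_tendsto_Linfty_def comp_def by blast
  obtain t :: "nat \<Rightarrow> nat" and u where "strict_mono t" and
    u: "u \<in> sublevel_sphere \<Omega> s p a0 L" "(\<lambda>n. Lp_norm p (v (t n) - u)) \<longlonglongrightarrow> 0"
    by (rule sublevel_sphere_convergent_subsequence[OF p s \<Omega> \<alpha> a a0 weak' v(1)])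
  have "\<delta> \<le> 0"
    using v(2)[OF u(1)] by (intro LIMSEQ_le_const[OF u(2)]) auto
  with \<delta> show False by simp
qed

text \<open>For fixed \<open>u\<close> the quotient is itself an L^1 test function.\<close>

lemma weighted_seminorm_tendsto:
  assumes "0 < p" "weak_star_tendsto_Linfty lebesgue a a0" "u \<in> Wsp_space s p"
    and "\<And>n. elliptic_weight \<alpha> \<beta> (a n)" "0 \<le> \<alpha>"
  shows "(\<lambda>n. weighted_seminorm (a n) s p u) \<longlonglongrightarrow> weighted_seminorm a0 s p u"
proof -
  have lim: "(\<lambda>n. LINT z|lebesgue. a n z * gagliardo_quotient s p u z)
      \<longlonglongrightarrow> (LINT z|lebesgue. a0 z * gagliardo_quotient s p u z)"
    using assms(2) Wsp_spaceD(3)[OF assms(3)] by (simp add: weak_star_tendsto_Linfty_def)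
  moreover have "0 \<le> (LINT z|lebesgue. a n z * gagliardo_quotient s p u z)" for n
    using weighted_seminorm_powr[OF assms(1,5,4), of n s u] by (metis powr_ge_zero)
  ultimately show ?thesis
    unfolding weighted_seminorm_def using assms(1)
    by (intro tendsto_powr'[OF lim tendsto_const]) auto
qed

section \<open>Passage to the limit in the min-max levels\<close>

lemma ex_genus_family_sublevel:
  assumes "minmax_value \<Omega> s p a k < ennreal L"
  obtains G where "G \<in> genus_family \<Omega> s p k" "G \<subseteq> sublevel_sphere \<Omega> s p a L"
proof -
  obtain G where G: "G \<in> genus_family \<Omega> s p k"
    "(SUP v\<in>G. ennreal (weighted_seminorm a s p v / Lp_norm p v)) < ennreal L"
    using assms unfolding minmax_value_def INF_less_iff by blast
  have "v \<in> sublevel_sphere \<Omega> s p a L" if v: "v \<in> G" for v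
  proof -
    have v': "v \<in> Wsp0_space \<Omega> s p" "Lp_norm p v = 1"
      using G(1) v by (auto simp: genus_family_def)
    have "ennreal (weighted_seminorm a s p v / Lp_norm p v) < ennreal L"
      using SUP_upper[OF v] G(2) by (rule le_less_trans)
    then show ?thesis
      using v' by (simp add: sublevel_sphere_def ennreal_less_iff)
  qed
  then show thesis
    using that G(1) by blast
qed

theorem theorem4p7:
  fixes \<Omega> :: "'a::euclidean_space set"
    and s p \<alpha> \<beta> :: real
    and a :: "nat \<Rightarrow> 'a \<times> 'a \<Rightarrow> real"
  assumes "open \<Omega>" and "bounded \<Omega>" and "\<Omega> \<noteq> {}"
    and "0 < s" and "s < 1" and "1 < p"
    and "0 < \<alpha>" and "\<alpha> \<le> \<beta>"
    and "\<And>n. a n \<in> Linfty_space lebesgue"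
    and "\<And>n. AE (x, y) in lebesgue. a n (x, y) = a n (y, x)"
    and "\<And>n. AE (x, y) in lebesgue. \<alpha> \<le> a n (x, y) \<and> a n (x, y) \<le> \<beta>"
    and "weak_star_tendsto_Linfty lebesgue a (a 0)"
  shows "\<forall>k\<ge>1. (\<lambda>n. minmax_value \<Omega> s p (a n) k) \<longlonglongrightarrow> minmax_value \<Omega> s p (a 0) k"
proof (intro allI impI)
  fix k :: nat
  have p: "1 \<le> p" and p0: "0 < p" and \<alpha>0: "0 \<le> \<alpha>"
    using assms by auto
  have a: "elliptic_weight \<alpha> \<beta> (a n)" for n
    using assms(9)[of n] assms(11)[of n] by (simp add: elliptic_weight_def Linfty_space_def split_beta)
  note weak = assms(12)
  let ?S = "\<lambda>n. sublevel_sphere \<Omega> s p (a n)"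
  have S: "u \<in> Wsp0_space \<Omega> s p" "weighted_seminorm (a n) s p u \<le> L" if "u \<in> ?S n L" for u n L
    using that by (auto simp: sublevel_sphere_def)
  show "(\<lambda>n. minmax_value \<Omega> s p (a n) k) \<longlonglongrightarrow> minmax_value \<Omega> s p (a 0) k"
  proof (rule order_tendstoI)
    fix c assume c: "minmax_value \<Omega> s p (a 0) k < c"
    \<comment> \<open>Room for the successive losses: a competitor for the limit weight lies below
      \<open>l\<close>, convergence on the net moves the level to \<open>b\<close>, the factor
      \<open>1 / (1 - \<delta>)\<close> moves it to \<open>c'\<close>, still strictly below
      \<open>c\<close>.\<close>
    obtain l b c' where lbc: "minmax_value \<Omega> s p (a 0) k < l" "l < b" "b < c'" "c' < c"
      using c dense by meson
    then have "l < top" "b < top" "c' < top"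
      using less_top_ennreal by (meson order_less_le_trans top_greatest order.strict_trans)+
    then obtain L B C where LBC: "l = ennreal L" "0 \<le> L" "b = ennreal B" "0 \<le> B" "c' = ennreal C" "0 \<le> C"
      by (metis ennreal_cases less_irrefl)
    have LB: "0 \<le> L" "L < B" "B < C"
      using lbc LBC by (auto simp: ennreal_less_iff)
    \<comment> \<open>The solution of \<open>B / (1 - \<delta>) = C\<close>; it lies strictly
      between 0 and 1 because \<open>0 < B < C\<close>.\<close>
    define \<delta> where "\<delta> = 1 - B / C"
    have \<delta>: "0 < \<delta>" "\<delta> < 1" "B / (1 - \<delta>) = C"
      using LB by (auto simp: \<delta>_def)
    \<comment> \<open>Neither this competitor nor the net chosen next depends on \<open>n\<close>;
      only the energies of the net points vary.\<close>
    obtain G where G: "G \<in> genus_family \<Omega> s p k" "G \<subseteq> ?S 0 L"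
      using ex_genus_family_sublevel lbc(1) unfolding LBC(1) by blast
    obtain U where U: "finite U" "U \<subseteq> ?S 0 L" "\<And>v. v \<in> ?S 0 L \<Longrightarrow> \<exists>u\<in>U. Lp_norm p (v - u) < \<delta>"
      using sublevel_sphere_finite_net[OF p assms(4,2,7) a \<delta>(1)] by blast
    have "\<forall>\<^sub>F n in sequentially. weighted_seminorm (a n) s p u < B" if "u \<in> U" for u
    proof -
      have u: "u \<in> ?S 0 L"
        using that U(2) by blast
      have "weighted_seminorm (a 0) s p u < B"
        using S(2)[OF u] LB(2) by linarith
      with weighted_seminorm_tendsto[OF p0 weak Wsp0_spaceD(1)[OF S(1)[OF u]] a \<alpha>0]
      show ?thesis
        by (rule order_tendstoD(2))
    qed
    then have "\<forall>\<^sub>F n in sequentially. \<forall>u\<in>U. weighted_seminorm (a n) s p u < B"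
      using U(1) by (simp add: eventually_ball_finite_distrib)
    then show "\<forall>\<^sub>F n in sequentially. minmax_value \<Omega> s p (a n) k < c"
    proof eventually_elim
      case (elim n)
      have "minmax_value \<Omega> s p (a n) k \<le> ennreal (B / (1 - \<delta>))"
        using U S G elim \<delta>
        by (intro minmax_value_le_of_net[OF p assms(7) a, of U]) (auto intro: less_imp_le)
      then show ?case
        using lbc(4) LBC \<delta>(3) by (auto intro: le_less_trans)
    qed
  next
    fix l assume l: "l < minmax_value \<Omega> s p (a 0) k"
    \<comment> \<open>The net will lie in a sublevel set of the limit energy itself, so two
      intermediate levels suffice.\<close>
    obtain b c' where lbc: "l < b" "b < c'" "c' < minmax_value \<Omega> s p (a 0) k"
      using l dense by meson
    then have "b < top" "c' < top"
      by (meson order_less_le_trans top_greatest order.strict_trans)+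
    then obtain B C where BC: "b = ennreal B" "0 \<le> B" "c' = ennreal C" "0 \<le> C"
      by (metis ennreal_cases less_irrefl)
    \<comment> \<open>\<open>l < b\<close> excludes \<open>B = 0\<close>, for which \<delta> below
      would be 1.\<close>
    have "0 < ennreal B"
      using lbc(1) BC(1) by (metis gr_zeroI not_less_zero)
    then have B: "0 < B" "B < C"
      using lbc BC by (auto simp: ennreal_less_iff)
    define \<delta> where "\<delta> = 1 - B / C"
    have \<delta>: "0 < \<delta>" "\<delta> < 1" "B / (1 - \<delta>) = C"
      using B by (auto simp: \<delta>_def)
    \<comment> \<open>Half of \<delta> is for reaching the limit sublevel set, the other half for
      reaching the net inside it.\<close>
    obtain U where U: "finite U" "U \<subseteq> ?S 0 B" "\<And>v. v \<in> ?S 0 B \<Longrightarrow> \<exists>u\<in>U. Lp_norm p (v - u) < \<delta> / 2"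
      using sublevel_sphere_finite_net[OF p assms(4,2,7) a, of "\<delta> / 2"] \<delta>(1) by (metis half_gt_zero)
    have "\<forall>\<^sub>F n in sequentially. \<forall>v\<in>?S n B. \<exists>u\<in>?S 0 B. Lp_norm p (v - u) < \<delta> / 2"
      using \<delta>(1) by (intro eventually_sublevel_sphere_near[OF p assms(4,2,7) a a weak]) simp
    then show "\<forall>\<^sub>F n in sequentially. l < minmax_value \<Omega> s p (a n) k"
    proof eventually_elim
      case (elim n)
      show ?case
      proof (rule ccontr)
        \<comment> \<open>A competitor for \<open>a n\<close> below level \<open>B\<close> would lie
          \<delta>-close to the net of the limit sublevel set and push the limit level down to
          \<open>C\<close>.\<close>
        assume "\<not> ?case"
        then have "minmax_value \<Omega> s p (a n) k < ennreal B"
          using lbc(1) BC(1) by (metis linorder_not_less order_le_less_trans)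
        then obtain G where G: "G \<in> genus_family \<Omega> s p k" "G \<subseteq> ?S n B"
          by (rule ex_genus_family_sublevel)
        have "\<exists>u\<in>U. Lp_norm p (v - u) < \<delta>" if v: "v \<in> G" for v
        proof -
          obtain w where w: "w \<in> ?S 0 B" "Lp_norm p (v - w) < \<delta> / 2"
            using elim G(2) v by blast
          obtain u where u: "u \<in> U" "Lp_norm p (w - u) < \<delta> / 2"
            using U(3)[OF w(1)] by blast
          have "v \<in> Lp_space p" "w \<in> Lp_space p" "u \<in> Lp_space p"
            using G(2) v w(1) u(1) U(2) S(1) Wsp0_spaceD(2) by blast+
          then have "Lp_norm p (v - u) \<le> Lp_norm p (v - w) + Lp_norm p (w - u)"
            by (intro Lp_norm_triangle p)
          then have "Lp_norm p (v - u) < \<delta>"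
            using w(2) u(2) by linarith
          then show ?thesis
            using u(1) by blast
        qed
        then have "minmax_value \<Omega> s p (a 0) k \<le> ennreal (B / (1 - \<delta>))"
          using U S G \<delta> by (intro minmax_value_le_of_net[OF p assms(7) a, of U]) auto
        then show False
          using lbc(3) BC \<delta>(3) by auto
      qed
    qed
  qed
qed

end
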